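(* Let $n\ge2$ be an integer and let $L,\mu,\Delta,\varepsilon>0$. Put $\alpha=\min\left\{1,\frac{8(\sqrt3+1)\sqrt n\,\mu}{45L},\sqrt{\frac n{270}}\right\}$ and assume $\varepsilon^2\le\frac{\Delta L\alpha}{435456\sqrt n}$. Then $$\mathfrak m^{\mathrm{NC}}(\varepsilon,\Delta,L,\mu)=\Omega\left(n+\frac{\Delta L\sqrt{n\alpha}}{\varepsilon^2}\right).$$
   Context: Norms are Euclidean. $\mathcal P_{\mathcal X}$ is Euclidean projection onto a closed convex set $\mathcal X$. Problem: $\min_{x\in\mathcal X}f(x)=\frac1n\sum_{i=1}^nf_i(x)$ with $\mathcal X\subseteq\mathbb R^d$ closed and convex. A family $\{f_i\}_{i=1}^n$ of differentiable functions is $L$-average smooth if $\frac1n\sum_i\|\nabla f_i(x_1)-\nabla f_i(x_2)\|^2\le L^2\|x_1-x_2\|^2$ for all $x_1,x_2$ in the domain. For $\mu>0$, $f$ is $(-\mu)$-weakly convex if $f+\frac\mu2\|\cdot\|^2$ is convex. PIFO algorithms. Fix an absolute constant $c_0>0$ (e.g. $c_0=2$). The oracle $h^{\mathrm{PIFO}}_{f_i}(x,\gamma)$, $\gamma>0$, returns $[f_i(x),\nabla f_i(x),\mathrm{prox}^\gamma_{f_i}(x)]$ with $\mathrm{prox}^\gamma_{f_i}(x)=\arg\min_{u\in\mathbb R^d}\{f_i(u)+\frac1{2\gamma}\|x-u\|^2\}$ (when $f_i$ is nonconvex, $\gamma$ must be such that the minimized function is convex in $u$). The oracle $h^{\mathrm{FO}}_f(x)$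 returns $[f(x),\nabla f(x)]$. A PIFO algorithm $\mathcal A$ fixes a distribution $\mathcal D$ on $\{1,\dots,n\}$ and $0<q\le c_0/n$, starts at $x_0=0$ with $\mathcal H=\{x_0\}$, and at step $t=1,2,\dots$: (i) samples $i_t\sim\mathcal D$ and queries $h^{\mathrm{PIFO}}_{f_{i_t}}$; (ii) samples $a_t\sim\mathrm{Bernoulli}(q)$ and, if $a_t=1$, queries $h^{\mathrm{FO}}_f$ and adds $x_{t-1}$ to $\mathcal H$; (iii) chooses $\tilde x_t$ in the linear span of $x_0,\dots,x_{t-1}$, of $\mathrm{prox}^{\gamma_j}_{f_{i_j}}(x_l)$ and $\nabla f_{i_j}(x_l)$ for $l<j\le t$, and of $\nabla f(u)$ for $u\in\mathcal H$; (iv) sets $x_t=\mathcal P_{\mathcal X}(\tilde x_t)$; (v) outputs $x_t$ or continues with $t+1$. The pairs $(i_t,a_t)$, $t\ge1$, are mutually independent and $i_t$ is independent of $a_t$. $\mathscr A$ is the class of all PIFO algorithms. Complexity. $\mathcal F_{\mathrm{NC}}(\Delta,L,\mu)$ is the set of $f=\frac1n\sum_{i=1}^nf_i:\mathcal X\to\mathbb R$ (any dimension $d$) with $f(0)-\inf_{x\in\mathcal X}f(x)\le\Delta$, $\{f_i\}$ $L$-average smooth and $f$ $(-\mu)$-weakly convex. $T(\mathcal A,f,\varepsilon)=\inf\{T\in\mathbb N:\mathbb E\|\nabla f(x_{\mathcal A,T})\|<\varepsilon\}$, where $x_{\mathcal A,T}$ is the point obtained by $\mathcal A$ at time-step $T$.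 $\mathfrak m^{\mathrm{NC}}(\varepsilon,\Delta,L,\mu)=\inf_{\mathcal A\in\mathscr A}\sup_{f\in\mathcal F_{\mathrm{NC}}(\Delta,L,\mu)}T(\mathcal A,f,\varepsilon)$. $\Omega(g)$ means at least $c\,g$ with an absolute constant $c>0$ not depending on any problem parameter ($c_0$ being a fixed constant). *)

theory Defs
  imports "HOL-Probability.Probability"
begin

text \<open>
  The complexity measure takes a supremum over problems of all dimensions, so the dimension
  cannot be a type. All spaces \<open>\<real>\<^sup>d\<close> are therefore realised inside one real inner product space,
  that of the finitely supported real sequences, as the subspaces \<open>E d\<close> of sequences supported
  on \<open>{..<d}\<close>.
\<close>

typedef rvec = "{x :: nat \<Rightarrow> real. finite {i. x i \<noteq> 0}}"
  morphisms coord Abs_rvec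
  by (rule exI[of _ "\<lambda>_. 0"]) simp

setup_lifting type_definition_rvec

lemma finite_supp [simp]: "finite {i. coord x i \<noteq> 0}"
  using coord[of x] by simp

lemma rvec_eqI: "(\<And>i. coord x i = coord y i) \<Longrightarrow> x = y"
  by (simp add: coord_inject[symmetric] fun_eq_iff)

instantiation rvec :: real_vector
begin

lift_definition zero_rvec :: rvec is "\<lambda>_. 0" by simp

lift_definition plus_rvec :: "rvec \<Rightarrow> rvec \<Rightarrow> rvec" is "\<lambda>x y i. x i + y i"
proof -
  fix f g :: "nat \<Rightarrow> real"
  assume "finite {i. f i \<noteq> 0}" "finite {i. g i \<noteq> 0}"
  then show "finite {i. f i + g i \<noteq> 0}"
    by (rule_tac finite_subset[of _ "{i. f i \<noteq> 0} \<union> {i. g i \<noteq> 0}"]) auto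
qed

lift_definition uminus_rvec :: "rvec \<Rightarrow> rvec" is "\<lambda>x i. - x i" by simp

lift_definition minus_rvec :: "rvec \<Rightarrow> rvec \<Rightarrow> rvec" is "\<lambda>x y i. x i - y i"
proof -
  fix f g :: "nat \<Rightarrow> real"
  assume "finite {i. f i \<noteq> 0}" "finite {i. g i \<noteq> 0}"
  then show "finite {i. f i - g i \<noteq> 0}"
    by (rule_tac finite_subset[of _ "{i. f i \<noteq> 0} \<union> {i. g i \<noteq> 0}"]) auto
qed

lift_definition scaleR_rvec :: "real \<Rightarrow> rvec \<Rightarrow> rvec" is "\<lambda>r x i. r * x i"
  by (rule finite_subset) auto

instance
  by standard (transfer; simp add: fun_eq_iff algebra_simps)+

end

lemmas coord_simps [simp] =
  zero_rvec.rep_eq plus_rvec.rep_eq uminus_rvec.rep_eq minus_rvec.rep_eq scaleR_rvec.rep_eq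

instantiation rvec :: real_inner
begin

definition inner_rvec :: "rvec \<Rightarrow> rvec \<Rightarrow> real" where
  "inner_rvec x y = (\<Sum>i | coord x i \<noteq> 0. coord x i * coord y i)"

definition norm_rvec :: "rvec \<Rightarrow> real" where
  "norm_rvec x = sqrt (inner x x)"

definition dist_rvec :: "rvec \<Rightarrow> rvec \<Rightarrow> real" where
  "dist_rvec x y = norm (x - y)"

definition sgn_rvec :: "rvec \<Rightarrow> rvec" where
  "sgn_rvec x = x /\<^sub>R norm x"

definition uniformity_rvec :: "(rvec \<times> rvec) filter" where
  "uniformity_rvec = (INF e\<in>{0<..}. principal {(x, y). dist x y < e})"

definition open_rvec :: "rvec set \<Rightarrow> bool" where
  "open_rvec U = (\<forall>x\<in>U. \<forall>\<^sub>F (x', y) in uniformity. x' = x \<longrightarrow> y \<in> U)"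

lemma inner_rvec_superset:
  "finite S \<Longrightarrow> {i. coord x i \<noteq> 0} \<subseteq> S \<Longrightarrow> inner x y = (\<Sum>i\<in>S. coord x i * coord y i)"
  unfolding inner_rvec_def by (rule sum.mono_neutral_left) auto

instance
proof
  fix x y z :: rvec and r :: real
  define S where
    "S = {i. coord x i \<noteq> 0} \<union> {i. coord y i \<noteq> 0}"
  have S: "finite S" by (simp add: S_def)
  have eq: "inner u w = (\<Sum>i\<in>S. coord u i * coord w i)"
    if "\<And>i. coord u i \<noteq> 0 \<Longrightarrow> coord x i \<noteq> 0 \<or> coord y i \<noteq> 0" for u w
    using that by (intro inner_rvec_superset[OF S]) (auto simp: S_def)
  show "inner x y = inner y x"
    by (simp add: eq mult.commute)
  show "inner (x + y) z = inner x z + inner y z"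
    by (subst (1 2 3) eq) (auto simp: algebra_simps sum.distrib)
  show "inner (r *\<^sub>R x) y = r * inner x y"
    by (subst (1 2) eq) (auto simp: sum_distrib_left mult.assoc)
  show "0 \<le> inner x x"
    by (simp add: inner_rvec_def sum_nonneg)
  show "(inner x x = 0) = (x = 0)"
    by (auto simp: inner_rvec_def sum_nonneg_eq_0_iff intro!: rvec_eqI)
qed (simp_all add: norm_rvec_def dist_rvec_def sgn_rvec_def uniformity_rvec_def open_rvec_def)

end

definition E :: "nat \<Rightarrow> rvec set" where
  "E d = {x. \<forall>i\<ge>d. coord x i = 0}"

lemma subspace_E: "subspace (E d)"
  by (auto simp: E_def subspace_def)

lemma norm_E: "x \<in> E d \<Longrightarrow> norm x = L2_set (coord x) {..<d}"
  unfolding norm_rvec_def L2_set_def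
  by (subst inner_rvec_superset[of "{..<d}"]) (auto simp: E_def power2_eq_square not_le[symmetric])

definition grad :: "nat \<Rightarrow> (rvec \<Rightarrow> real) \<Rightarrow> rvec \<Rightarrow> rvec" where
  "grad d f x = (THE g. g \<in> E d \<and> (f has_derivative (\<lambda>h. inner g h)) (at x within E d))"

definition proj :: "rvec set \<Rightarrow> rvec \<Rightarrow> rvec" where
  "proj X x = (THE y. y \<in> X \<and> (\<forall>z\<in>X. dist x y \<le> dist x z))"

text \<open>
  The proximal operator is partial: it is defined only if the minimised function is convex
  and has exactly one minimiser. The oracle answers \<open>None\<close> otherwise.
\<close>

definition prox_objective :: "(rvec \<Rightarrow> real) \<Rightarrow> real \<Rightarrow> rvec \<Rightarrow> rvec \<Rightarrow> real" where
  "prox_objective f \<gamma> x u = f u + 1 / (2 * \<gamma>) * (norm (x - u))\<^sup>2"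

definition is_prox :: "nat \<Rightarrow> (rvec \<Rightarrow> real) \<Rightarrow> real \<Rightarrow> rvec \<Rightarrow> rvec \<Rightarrow> bool" where
  "is_prox d f \<gamma> x u \<longleftrightarrow>
     u \<in> E d \<and> (\<forall>v\<in>E d. prox_objective f \<gamma> x u \<le> prox_objective f \<gamma> x v)"

definition prox :: "nat \<Rightarrow> (rvec \<Rightarrow> real) \<Rightarrow> real \<Rightarrow> rvec \<Rightarrow> rvec option" where
  "prox d f \<gamma> x =
     (if convex_on (E d) (prox_objective f \<gamma> x) \<and> (\<exists>!u. is_prox d f \<gamma> x u)
      then Some (THE u. is_prox d f \<gamma> x u) else None)"

type_synonym fo_answer = "real \<times> rvec"
type_synonym pifo_answer = "real \<times> rvec \<times> rvec option"

definition fo_oracle :: "nat \<Rightarrow> (rvec \<Rightarrow> real) \<Rightarrow> rvec \<Rightarrow> fo_answer" where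
  "fo_oracle d f x = (f x, grad d f x)"

definition pifo_oracle :: "nat \<Rightarrow> (rvec \<Rightarrow> real) \<Rightarrow> rvec \<Rightarrow> real \<Rightarrow> pifo_answer" where
  "pifo_oracle d f x \<gamma> = (f x, grad d f x, prox d f \<gamma> x)"

text \<open>
  The components live on all of \<open>\<real>\<^sup>d\<close>, because the proximal operator minimises over \<open>\<real>\<^sup>d\<close>.
  Only the components with index in \<open>{1..n}\<close> and their values on \<open>E (dimen P)\<close> are relevant.
\<close>

record fs_problem =
  dimen :: nat
  feasible :: "rvec set"
  component :: "nat \<Rightarrow> rvec \<Rightarrow> real"

definition objective :: "nat \<Rightarrow> fs_problem \<Rightarrow> rvec \<Rightarrow> real" where
  "objective n P x = (\<Sum>i=1..n. component P i x) / real n"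

definition wf_problem :: "nat \<Rightarrow> fs_problem \<Rightarrow> bool" where
  "wf_problem n P \<longleftrightarrow>
     feasible P \<subseteq> E (dimen P) \<and> closed (feasible P) \<and> convex (feasible P) \<and> 0 \<in> feasible P \<and>
     (\<forall>i\<in>{1..n}. component P i differentiable_on E (dimen P))"

definition average_smooth :: "nat \<Rightarrow> real \<Rightarrow> fs_problem \<Rightarrow> bool" where
  "average_smooth n L P \<longleftrightarrow>
     (\<forall>x\<in>feasible P. \<forall>y\<in>feasible P.
        (\<Sum>i=1..n. (norm (grad (dimen P) (component P i) x - grad (dimen P) (component P i) y))\<^sup>2)
          / real n \<le> L\<^sup>2 * (norm (x - y))\<^sup>2)"

definition weakly_convex_on :: "rvec set \<Rightarrow> real \<Rightarrow> (rvec \<Rightarrow> real) \<Rightarrow> bool" where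
  "weakly_convex_on X \<mu> f \<longleftrightarrow> convex_on X (\<lambda>x. f x + \<mu> / 2 * (norm x)\<^sup>2)"

definition F_NC :: "nat \<Rightarrow> real \<Rightarrow> real \<Rightarrow> real \<Rightarrow> fs_problem set" where
  "F_NC n \<Delta> L \<mu> =
     {P. wf_problem n P \<and>
         bdd_below (objective n P ` feasible P) \<and>
         objective n P 0 - (INF x\<in>feasible P. objective n P x) \<le> \<Delta> \<and>
         average_smooth n L P \<and>
         weakly_convex_on (feasible P) \<mu> (objective n P)}"

text \<open>
  What an algorithm learns in step \<open>j\<close>: the sampled index \<open>i\<^sub>j\<close>, the coin \<open>a\<^sub>j\<close>, the parameter
  \<open>\<gamma>\<^sub>j\<close> of its component query, the answers of the component oracle at \<open>x\<^sub>0, \<dots>, x\<^bsub>j-1\<^esub>\<close>, and,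
  if \<open>a\<^sub>j = 1\<close>, the answer of the full first-order oracle at \<open>x\<^bsub>j-1\<^esub>\<close>.
\<close>

datatype observation = Observation
  (obs_index: nat) (obs_coin: bool) (obs_param: real)
  (obs_pifo: "pifo_answer list") (obs_fo: "fo_answer option")

text \<open>
  The history after step \<open>t\<close> consists of \<open>x\<^sub>0, \<dots>, x\<^sub>t\<close>, the full first-order answer at \<open>x\<^sub>0\<close>
  (which belongs to \<open>\<H>\<close> from the start), and the observations of steps \<open>1, \<dots>, t\<close>.
\<close>

type_synonym history = "rvec list \<times> fo_answer \<times> observation list"

definition obs_vectors :: "observation \<Rightarrow> rvec set" where
  "obs_vectors ob =
     (\<Union>(v, g, p)\<in>set (obs_pifo ob). insert g (set_option p)) \<union> snd ` set_option (obs_fo ob)"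

fun history_vectors :: "history \<Rightarrow> rvec set" where
  "history_vectors (xs, r, obs) = set xs \<union> {snd r} \<union> (\<Union>ob\<in>set obs. obs_vectors ob)"

text \<open>
  The rules \<open>param_rule\<close> and \<open>next_rule\<close> see the dimension, the feasible set, the seed and the
  history, but the component functions only through the oracle answers in the history.
  The seed, a real number drawn independently of all samples, gives the algorithm internal
  randomness for its choices; deterministic rules are those ignoring it.
\<close>

record pifo_algorithm =
  index_dist :: "nat pmf"
  full_prob :: real
  seed_dist :: "real measure"
  param_rule :: "nat \<Rightarrow> rvec set \<Rightarrow> real \<Rightarrow> history \<Rightarrow> nat \<Rightarrow> real"
  next_rule :: "nat \<Rightarrow> rvec set \<Rightarrow> real \<Rightarrow> history \<Rightarrow> rvec"

definition observe ::
  "nat \<Rightarrow> pifo_algorithm \<Rightarrow> fs_problem \<Rightarrow> real \<Rightarrow> history \<Rightarrow> nat \<times> bool \<Rightarrow> observation" where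
  "observe n A P \<omega> h = (\<lambda>(i, a).
     let xs = fst h; \<gamma> = param_rule A (dimen P) (feasible P) \<omega> h i
     in Observation i a \<gamma>
          (map (\<lambda>x. pifo_oracle (dimen P) (component P i) x \<gamma>) xs)
          (if a then Some (fo_oracle (dimen P) (objective n P) (last xs)) else None))"

text \<open>
  The sample path \<open>s\<close> assigns to every step \<open>t \<ge> 1\<close> the pair \<open>(i\<^sub>t, a\<^sub>t)\<close>. An algorithm that
  outputs \<open>x\<^sub>t\<close> and stops is one that keeps returning \<open>x\<^sub>t\<close> from then on.
\<close>

primrec run ::
  "nat \<Rightarrow> pifo_algorithm \<Rightarrow> fs_problem \<Rightarrow> real \<Rightarrow> (nat \<Rightarrow> nat \<times> bool) \<Rightarrow> nat \<Rightarrow> history" where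
  "run n A P \<omega> s 0 = ([0], fo_oracle (dimen P) (objective n P) 0, [])"
| "run n A P \<omega> s (Suc t) =
     (let h = run n A P \<omega> s t;
          (xs, r, obs) = h;
          obs' = obs @ [observe n A P \<omega> h (s (Suc t))]
      in (xs @ [proj (feasible P) (next_rule A (dimen P) (feasible P) \<omega> (xs, r, obs'))], r, obs'))"

definition iterate ::
  "nat \<Rightarrow> pifo_algorithm \<Rightarrow> fs_problem \<Rightarrow> real \<Rightarrow> (nat \<Rightarrow> nat \<times> bool) \<Rightarrow> nat \<Rightarrow> rvec" where
  "iterate n A P \<omega> s t = last (fst (run n A P \<omega> s t))"

definition PIFO :: "real \<Rightarrow> nat \<Rightarrow> pifo_algorithm set" where
  "PIFO c\<^sub>0 n =
     {A. set_pmf (index_dist A) \<subseteq> {1..n} \<and>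
         0 < full_prob A \<and> full_prob A \<le> c\<^sub>0 / real n \<and> full_prob A \<le> 1 \<and>
         prob_space (seed_dist A) \<and> sets (seed_dist A) = sets borel \<and>
         (\<forall>d X \<omega> h i. param_rule A d X \<omega> h i > 0) \<and>
         (\<forall>d X \<omega> h. next_rule A d X \<omega> h \<in> span (history_vectors h)) \<and>
         (\<forall>P s t. wf_problem n P \<longrightarrow> (\<forall>j. fst (s j) \<in> {1..n}) \<longrightarrow>
            (\<lambda>\<omega>. iterate n A P \<omega> s t) \<in> borel_measurable (seed_dist A))}"

definition sample_pmf :: "pifo_algorithm \<Rightarrow> nat \<Rightarrow> (nat \<Rightarrow> nat \<times> bool) pmf" where
  "sample_pmf A T =
     Pi_pmf {1..T} (1, False) (\<lambda>_. pair_pmf (index_dist A) (bernoulli_pmf (full_prob A)))"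

definition expected_grad_norm :: "nat \<Rightarrow> pifo_algorithm \<Rightarrow> fs_problem \<Rightarrow> nat \<Rightarrow> ennreal" where
  "expected_grad_norm n A P T =
     (\<integral>\<^sup>+\<omega>. (\<integral>\<^sup>+s. ennreal (norm (grad (dimen P) (objective n P) (iterate n A P \<omega> s T)))
        \<partial>measure_pmf (sample_pmf A T)) \<partial>seed_dist A)"

definition hitting_time :: "nat \<Rightarrow> pifo_algorithm \<Rightarrow> fs_problem \<Rightarrow> real \<Rightarrow> enat" where
  "hitting_time n A P \<epsilon> = Inf {enat T | T. expected_grad_norm n A P T < ennreal \<epsilon>}"

definition minimax_time :: "real \<Rightarrow> nat \<Rightarrow> fs_problem set \<Rightarrow> real \<Rightarrow> enat" where
  "minimax_time c\<^sub>0 n \<F> \<epsilon> = (INF A\<in>PIFO c\<^sub>0 n. SUP P\<in>\<F>. hitting_time n A P \<epsilon>)"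

definition m_NC :: "real \<Rightarrow> nat \<Rightarrow> real \<Rightarrow> real \<Rightarrow> real \<Rightarrow> real \<Rightarrow> enat" where
  "m_NC c\<^sub>0 n \<epsilon> \<Delta> L \<mu> = minimax_time c\<^sub>0 n (F_NC n \<Delta> L \<mu>) \<epsilon>"

text \<open>
  With a proper feasible set the gradient need not become small anywhere (already on \<open>X = {0}\<close>),
  so the following variant, where only the unconstrained members of the class (\<open>X = \<real>\<^sup>d\<close>)
  compete, carries the real content of a lower bound; it never exceeds \<open>m_NC\<close>.
\<close>

definition m_NC_unconstrained :: "real \<Rightarrow> nat \<Rightarrow> real \<Rightarrow> real \<Rightarrow> real \<Rightarrow> real \<Rightarrow> enat" where
  "m_NC_unconstrained c\<^sub>0 n \<epsilon> \<Delta> L \<mu> =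
     minimax_time c\<^sub>0 n {P \<in> F_NC n \<Delta> L \<mu>. feasible P = E (dimen P)} \<epsilon>"

definition alpha_NC :: "nat \<Rightarrow> real \<Rightarrow> real \<Rightarrow> real" where
  "alpha_NC n L \<mu> =
     Min {1, 8 * (sqrt 3 + 1) * sqrt (real n) * \<mu> / (45 * L), sqrt (real n / 270)}"

end

theory Submission
  imports Defs
begin

text \<open>
  The bound comes from a chain function on \<open>E d\<close>, that is, on \<open>d\<close> coordinates,
  \<open>F x = \<kappa> * (\<tau>/2 * (x\<^sub>0 - \<sigma>)\<^sup>2 + 1/2 * (\<Sum>l. (x\<^sub>l - x\<^bsub>l+1\<^esub>)\<^sup>2) + \<tau>\<^sup>2/(1-\<tau>) * (\<Sum>l. g x\<^sub>l))\<close>,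
  where \<open>g\<close> is stationary at \<open>0\<close> and has its minimum at \<open>\<sigma>\<close>. The quadratic coupling passes
  information along the chain one coordinate at a time. The separable terms with \<open>g\<close>, which are
  the only nonconvex ones, pass none, but they prevent the gradient from being small while the last
  coordinate is \<open>0\<close>.

  The couplings with odd \<open>l\<close> and the separable terms form one component, those with even \<open>l\<close>
  another; all other components vanish. Each of the two splits into blocks of at most two
  coordinates, so one step that samples it, even with its proximal operator, extends the support of
  the iterates by at most one coordinate (\<open>preserves_prox\<close>, \<open>run_support\<close>). The sampling
  distribution is fixed before the problem, so the two components can carry indices of probability at
  most \<open>2/n\<close> (\<open>two_unlikely_indices\<close>); full gradients have probability at most \<open>c\<^sub>0/n\<close>. Hence a step
  makes progress with probability at most \<open>(4 + c\<^sub>0)/n\<close>, and by Markov's inequality completing the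
  chain with probability one half takes order \<open>n * d\<close> steps (\<open>hitting_time_lower_bound\<close>).

  For an incomplete chain the gradient is tested against a two-sided geometric sequence centred
  where the iterate first drops below \<open>\<sigma>/4\<close> (\<open>bump_test\<close>). The geometric ratio makes the
  quadratic part cancel the linear part of \<open>g'\<close> everywhere except at the centre, which leaves
  \<open>(norm (grad F))\<^sup>2 \<ge> \<kappa>\<^sup>2 * \<tau>\<^sup>3 * \<sigma>\<^sup>2 / 8\<close> (\<open>norm_chain_grad_lower_bound\<close>).

  Concentrating \<open>F\<close> in two of \<open>n\<close> components costs a factor of order \<open>sqrt n\<close> in average
  smoothness, so \<open>\<kappa>\<close> has order \<open>L / sqrt n\<close>. Weak convexity requires \<open>\<kappa> * \<tau>\<^sup>2\<close> to be at most of
  order \<open>\<mu>\<close>, which \<open>\<tau>\<^sup>2 = \<alpha>/4\<close> achieves. The scale \<open>\<sigma>\<close> is then set by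
  \<open>\<epsilon>\<close>, and the gap \<open>\<Delta>\<close> allows a chain of length of order
  \<open>\<Delta> * L * sqrt \<alpha> / (sqrt n * \<epsilon>\<^sup>2)\<close>. The hypothesis on \<open>\<epsilon>\<close> makes this a large constant at least,
  which yields the summand \<open>n\<close> of the bound as well.
\<close>

section \<open>Coordinates, gradients and proximal points\<close>

lift_definition unit_vec :: "nat \<Rightarrow> rvec" is "\<lambda>k i. if i = k then 1 else 0" by simp

lemma coord_unit [simp]: "coord (unit_vec k) i = (if i = k then 1 else 0)"
  by transfer simp

lemma coord_sum [simp]: "coord (sum f A) i = (\<Sum>a\<in>A. coord (f a) i)"
  by (induction A rule: infinite_finite_induct) simp_all

lemma inner_unit [simp]: "inner (unit_vec k) x = coord x k"
  by (subst inner_rvec_superset[of "{k}"]) auto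

lemma coord_eq_inner: "coord x k = inner x (unit_vec k)"
  by (subst inner_commute) simp

lemma bounded_linear_coord: "bounded_linear (\<lambda>x. coord x k)"
  unfolding coord_eq_inner by (rule bounded_linear_inner_left)

lemma has_derivative_coord [derivative_intros]:
  "((\<lambda>x. coord x k) has_derivative (\<lambda>h. coord h k)) F"
  by (rule bounded_linear_imp_has_derivative[OF bounded_linear_coord])

lemma unit_in_E: "k < d \<Longrightarrow> unit_vec k \<in> E d"
  by (auto simp: E_def)

lemma E_mono: "k \<le> d \<Longrightarrow> E k \<subseteq> E d"
  by (auto simp: E_def)

lemma zero_in_E [simp]: "0 \<in> E d"
  by (simp add: E_def)

lemma closed_E: "closed (E d)"
proof -
  have "E d = (\<Inter>i\<in>{d..}. {x. coord x i = 0})"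
    by (auto simp: E_def)
  moreover have "closed {x. coord x i = 0}" for i
    by (intro closed_Collect_eq continuous_on_const
        linear_continuous_on bounded_linear_coord)
  ultimately show ?thesis by auto
qed

lemma convex_E: "convex (E d)"
  by (rule subspace_imp_convex[OF subspace_E])

lemma norm_square_E: "x \<in> E d \<Longrightarrow> (norm x)\<^sup>2 = (\<Sum>i<d. (coord x i)\<^sup>2)"
  by (simp add: norm_E L2_set_def sum_nonneg)

lemma proj_E: "x \<in> E d \<Longrightarrow> proj (E d) x = x"
  unfolding proj_def by (rule the_equality) (force simp: )+

lemma has_real_derivative_along_line:
  fixes x v :: rvec
  assumes "(f has_derivative inner G) (at x within range (\<lambda>t. x + t *\<^sub>R v))"
  shows "((\<lambda>t::real. f (x + t *\<^sub>R v)) has_real_derivative inner G v) (at 0)"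
proof -
  have "((\<lambda>t::real. x + t *\<^sub>R v) has_derivative (\<lambda>t. t *\<^sub>R v)) (at 0)"
    by (auto intro!: derivative_eq_intros)
  from has_derivative_in_compose[OF this, of f "inner G"] assms
  show ?thesis by (simp add: has_field_derivative_def mult_commute_abs)
qed

lemma grad_eqI:
  assumes "x \<in> E d" "G \<in> E d" "(f has_derivative inner G) (at x)"
  shows "grad d f x = G"
  unfolding grad_def
proof (rule the_equality)
  show "G \<in> E d \<and> (f has_derivative inner G) (at x within E d)"
    using assms has_derivative_at_withinI by blast
next
  fix G' assume G': "G' \<in> E d \<and> (f has_derivative inner G') (at x within E d)"
  define v where "v = G' - G"
  have v: "v \<in> E d" using G' assms by (auto simp: v_def intro: subspace_diff[OF subspace_E])
  have sub: "range (\<lambda>t::real. x + t *\<^sub>R v) \<subseteq> E d"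
    using assms(1) v by (auto intro!: subspace_add[OF subspace_E] subspace_mul[OF subspace_E])
  have "((\<lambda>t. f (x + t *\<^sub>R v)) has_real_derivative inner G' v) (at 0)"
    by (rule has_real_derivative_along_line[OF has_derivative_subset[OF conjunct2[OF G'] sub]])
  moreover have "((\<lambda>t. f (x + t *\<^sub>R v)) has_real_derivative inner G v) (at 0)"
    by (rule has_real_derivative_along_line[OF has_derivative_at_withinI[OF assms(3)]])
  ultimately have "inner G' v = inner G v" by (rule DERIV_unique)
  then have "inner v v = 0" by (simp add: v_def inner_diff_left)
  then show "G' = G" by (simp add: v_def)
qed

text \<open>
  The oracle of a function with this property reveals no new coordinate at points of \<open>E k\<close>:
  neither the gradient nor a proximal point leaves \<open>E k\<close>.
\<close>

definition preserves :: "nat \<Rightarrow> (rvec \<Rightarrow> real) \<Rightarrow> bool" where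
  "preserves k f \<longleftrightarrow> (\<forall>y\<in>E k. \<exists>G\<in>E k. (f has_derivative inner G) (at y))"

lemma preserves_grad:
  assumes "preserves k f" "k \<le> d" "x \<in> E k"
  shows "grad d f x \<in> E k"
proof -
  obtain G where "G \<in> E k" "(f has_derivative inner G) (at x)"
    using assms by (auto simp: preserves_def)
  moreover have "x \<in> E d" "G \<in> E d" using E_mono[OF assms(2)] assms \<open>G \<in> E k\<close> by auto
  ultimately show ?thesis using grad_eqI by auto
qed

text \<open>
  Cutting the minimiser down to \<open>E k\<close> changes it in directions along which the derivative of the
  objective at the cut-down point vanishes. By convexity the cut-down point is no worse, and by
  uniqueness it is the minimiser.
\<close>

lemma preserves_prox:
  assumes "preserves k f" "k \<le> d" "x \<in> E k" "prox d f \<gamma> x = Some u"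
  shows "u \<in> E k"
proof -
  let ?Q = "prox_objective f \<gamma> x"
  have cvx: "convex_on (E d) ?Q" and ex1: "\<exists>!u. is_prox d f \<gamma> x u"
    and u_eq: "u = (THE u. is_prox d f \<gamma> x u)"
    using assms(4) by (auto simp: prox_def split: if_splits)
  have u: "is_prox d f \<gamma> x u" unfolding u_eq using ex1 by (rule theI')
  define u' where "u' = (\<Sum>i<k. coord u i *\<^sub>R unit_vec i)"
  define v where "v = u - u'"
  have coord_u': "coord u' i = (if i < k then coord u i else 0)" for i
    by (auto simp: u'_def if_distrib cong: if_cong)
  have u'k: "u' \<in> E k" by (auto simp: E_def coord_u')
  have ud: "u \<in> E d" "u' \<in> E d" using u u'k E_mono[OF assms(2)] by (auto simp: is_prox_def)
  have vd: "v \<in> E d" unfolding v_def using ud by (rule subspace_diff[OF subspace_E])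
  obtain G where G: "G \<in> E k" "(f has_derivative inner G) (at u')"
    using assms(1) u'k by (auto simp: preserves_def)
  have orth: "inner w v = 0" if "w \<in> E k" for w
    unfolding inner_rvec_def using that
    by (intro sum.neutral) (auto simp: v_def coord_u' E_def not_le[symmetric])
  have f_line: "((\<lambda>t. f (u' + t *\<^sub>R v)) has_real_derivative 0) (at 0)"
    using has_real_derivative_along_line[OF has_derivative_at_withinI[OF G(2)], of v] orth[OF G(1)]
    by simp
  define c where "c = 1 / (2 * \<gamma>)"
  have Q_eq: "?Q (u' + t *\<^sub>R v) = f (u' + t *\<^sub>R v)
      + c * (inner (x - u') (x - u') + t\<^sup>2 * inner v v)" for t
  proof -
    define w where "w = x - u'"
    have "inner w v = 0"
      unfolding w_def using assms(3) u'k by (intro orth subspace_diff[OF subspace_E])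
    then have inner_eq: "inner (w - t *\<^sub>R v) (w - t *\<^sub>R v) = inner w w + t\<^sup>2 * inner v v"
      by (simp add: inner_diff inner_commute[of v w] power2_eq_square)
    have diff_eq: "x - (u' + t *\<^sub>R v) = w - t *\<^sub>R v" by (simp add: w_def)
    show ?thesis
      unfolding prox_objective_def power2_norm_eq_inner c_def diff_eq inner_eq w_def[symmetric] ..
  qed
  have deriv: "((\<lambda>t::real. ?Q (u' + t *\<^sub>R v)) has_real_derivative 0) (at 0)"
    unfolding Q_eq by (auto intro!: derivative_eq_intros f_line)
  have "convex_on UNIV (\<lambda>t::real. ?Q (u' + t *\<^sub>R v))"
  proof (rule convex_onI)
    fix t a b :: real assume t: "0 < t" "t < 1"
    have "?Q ((1 - t) *\<^sub>R (u' + a *\<^sub>R v) + t *\<^sub>R (u' + b *\<^sub>R v))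
        \<le> (1 - t) * ?Q (u' + a *\<^sub>R v) + t * ?Q (u' + b *\<^sub>R v)"
      using t ud vd
      by (intro convex_onD[OF cvx])
         (auto intro!: subspace_add[OF subspace_E] subspace_mul[OF subspace_E])
    moreover have "(1 - t) *\<^sub>R (u' + a *\<^sub>R v) + t *\<^sub>R (u' + b *\<^sub>R v)
        = u' + ((1 - t) *\<^sub>R a + t *\<^sub>R b) *\<^sub>R v"
      by (rule rvec_eqI) (simp add: algebra_simps)
    ultimately show "?Q (u' + ((1 - t) *\<^sub>R a + t *\<^sub>R b) *\<^sub>R v)
        \<le> (1 - t) * ?Q (u' + a *\<^sub>R v) + t * ?Q (u' + b *\<^sub>R v)" by simp
  qed simp
  from convex_on_imp_above_tangent[OF this, where c = 0 and x = 1 and f' = 0] deriv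
  have "?Q u' \<le> ?Q u" by (simp add: v_def)
  then have "is_prox d f \<gamma> x u'" using u ud by (force simp: is_prox_def)
  then have "u = u'" using ex1 u by blast
  with u'k show ?thesis by simp
qed

section \<open>Support growth along a run\<close>

text \<open>
  Sampling an index in \<open>I\<close> counts as progress even if it reveals nothing at the current point.
  This overestimate costs only a constant factor and makes the count independent of the iterates.
\<close>

definition progress :: "nat set \<Rightarrow> (nat \<Rightarrow> nat \<times> bool) \<Rightarrow> nat \<Rightarrow> nat" where
  "progress I s t = card {j \<in> {1..t}. fst (s j) \<in> I \<or> snd (s j)}"

lemma progress_0 [simp]: "progress I s 0 = 0"
  by (simp add: progress_def)

lemma progress_Suc:
  "progress I s (Suc t) =
     progress I s t + (if fst (s (Suc t)) \<in> I \<or> snd (s (Suc t)) then 1 else 0)"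
proof -
  have "{j \<in> {1..Suc t}. fst (s j) \<in> I \<or> snd (s j)} =
      {j \<in> {1..t}. fst (s j) \<in> I \<or> snd (s j)} \<union>
      (if fst (s (Suc t)) \<in> I \<or> snd (s (Suc t)) then {Suc t} else {})"
    by (auto simp: le_Suc_eq)
  then show ?thesis unfolding progress_def by (subst \<open>_ = _ \<union> _\<close>) (subst card_Un_disjoint; auto)
qed

text \<open>
  Preserving one of any two consecutive levels limits each oracle call to one new coordinate: from
  \<open>E k\<close> a component leads at most to \<open>E (Suc k)\<close>.
\<close>

definition zero_chain :: "nat \<Rightarrow> nat set \<Rightarrow> fs_problem \<Rightarrow> bool" where
  "zero_chain n I P \<longleftrightarrow> n > 0 \<and> feasible P = E (dimen P) \<and>
     (\<forall>i k. preserves k (component P i) \<or> preserves (Suc k) (component P i)) \<and>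
     (\<forall>i k. i \<notin> I \<longrightarrow> preserves k (component P i))"

lemma objective_grad_support:
  assumes "zero_chain n I P" "Suc k \<le> dimen P" "y \<in> E k"
  shows "grad (dimen P) (objective n P) y \<in> E (Suc k)"
proof -
  have "\<exists>G\<in>E (Suc k). (component P i has_derivative inner G) (at y)" for i
  proof -
    have "preserves k (component P i) \<or> preserves (Suc k) (component P i)"
      using assms(1) by (simp add: zero_chain_def)
    then show ?thesis
      using assms(3) E_mono[of k "Suc k"] unfolding preserves_def by fastforce
  qed
  then obtain G where G: "\<And>i. G i \<in> E (Suc k)"
    "\<And>i. (component P i has_derivative inner (G i)) (at y)"
    by metis
  define H where "H = (\<Sum>i=1..n. G i) /\<^sub>R real n"
  have H: "H \<in> E (Suc k)"
    unfolding H_def using G(1) by (intro subspace_mul[OF subspace_E] subspace_sum[OF subspace_E])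
  have "(objective n P has_derivative (\<lambda>h. (\<Sum>i=1..n. inner (G i) h) / real n)) (at y)"
    unfolding objective_def
    by (auto intro!: derivative_eq_intros G(2) simp: divide_inverse)
  moreover have "(\<lambda>h. (\<Sum>i=1..n. inner (G i) h) / real n) = inner H"
    by (simp add: H_def inner_sum_left divide_inverse mult.commute fun_eq_iff)
  ultimately have "(objective n P has_derivative inner H) (at y)" by simp
  moreover have "y \<in> E (dimen P)" "H \<in> E (dimen P)"
    using assms(2,3) H E_mono[of k "dimen P"] E_mono[of "Suc k" "dimen P"] by auto
  ultimately show ?thesis using H grad_eqI by metis
qed

lemma obs_vectors_support:
  assumes "zero_chain n I P" and xs: "set (fst h) \<subseteq> E k" "fst h \<noteq> []"
    and k': "k' = k + (if i \<in> I \<or> a then 1 else 0)" "k' \<le> dimen P"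
  shows "obs_vectors (observe n A P \<omega> h (i, a)) \<subseteq> E k'"
proof -
  let ?f = "component P i"
  have "k \<le> k'" using k' by simp
  have pres: "preserves k ?f \<or> preserves k' ?f"
    using assms(1) k' by (auto simp: zero_chain_def)
  have "grad (dimen P) ?f x \<in> E k'" if "x \<in> set (fst h)" for x
    using pres
  proof
    assume "preserves k ?f"
    then have "grad (dimen P) ?f x \<in> E k"
      using that xs \<open>k \<le> k'\<close> k' E_mono[of k k'] by (intro preserves_grad) auto
    then show ?thesis using E_mono[OF \<open>k \<le> k'\<close>] by auto
  next
    assume "preserves k' ?f"
    then have "grad (dimen P) ?f x \<in> E k'"
      using that xs \<open>k \<le> k'\<close> k' E_mono[of k k'] by (intro preserves_grad) auto
    then show ?thesis using E_mono[OF \<open>k \<le> k'\<close>] by auto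
  qed
  moreover have "u \<in> E k'" if "x \<in> set (fst h)" "prox (dimen P) ?f \<gamma> x = Some u" for x \<gamma> u
    using pres
  proof
    assume "preserves k ?f"
    then have "u \<in> E k"
      using that xs \<open>k \<le> k'\<close> k' E_mono[of k k'] by (intro preserves_prox[OF _ _ _ that(2)]) auto
    then show ?thesis using E_mono[OF \<open>k \<le> k'\<close>] by auto
  next
    assume "preserves k' ?f"
    then have "u \<in> E k'"
      using that xs \<open>k \<le> k'\<close> k' E_mono[of k k'] by (intro preserves_prox[OF _ _ _ that(2)]) auto
    then show ?thesis using E_mono[OF \<open>k \<le> k'\<close>] by auto
  qed
  moreover have "grad (dimen P) (objective n P) (last (fst h)) \<in> E k'" if a
    using objective_grad_support[OF assms(1), of k "last (fst h)"] that xs k'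
      subsetD[OF xs(1) last_in_set[OF xs(2)]] by auto
  ultimately show ?thesis
    by (auto simp: observe_def Let_def obs_vectors_def pifo_oracle_def fo_oracle_def
        split: if_splits option.splits)
qed

text \<open>
  The support starts at \<open>E 1\<close> rather than \<open>E 0\<close> because the full gradient at \<open>0\<close> is known
  before the first step.
\<close>

lemma run_support:
  assumes zc: "zero_chain n I P" and A: "A \<in> PIFO c n"
  shows "Suc (progress I s t) \<le> dimen P \<Longrightarrow>
    history_vectors (run n A P \<omega> s t) \<subseteq> E (Suc (progress I s t)) \<and> fst (run n A P \<omega> s t) \<noteq> []"
proof (induction t)
  case 0
  then show ?case using objective_grad_support[OF zc, of 0 0] by (simp add: fo_oracle_def)
next
  case (Suc t)
  let ?d = "dimen P"
  define k k' where "k = Suc (progress I s t)" and "k' = Suc (progress I s (Suc t))"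
  have kk': "k' = k + (if fst (s (Suc t)) \<in> I \<or> snd (s (Suc t)) then 1 else 0)" "k' \<le> ?d"
    using Suc.prems by (auto simp: k_def k'_def progress_Suc)
  then have "k \<le> k'" by simp
  obtain xs r obs where h: "run n A P \<omega> s t = (xs, r, obs)" by (cases "run n A P \<omega> s t")
  have IH: "history_vectors (xs, r, obs) \<subseteq> E k" "xs \<noteq> []"
    using Suc.IH h kk' by (auto simp: k_def)
  define ob where "ob = observe n A P \<omega> (xs, r, obs) (s (Suc t))"
  have "obs_vectors ob \<subseteq> E k'"
    unfolding ob_def using obs_vectors_support[OF zc, of "(xs, r, obs)" k k'] IH kk'
    by (cases "s (Suc t)") auto
  then have hist: "history_vectors (xs, r, obs @ [ob]) \<subseteq> E k'"
    using IH(1) E_mono[OF \<open>k \<le> k'\<close>] by auto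
  define x where "x = next_rule A ?d (feasible P) \<omega> (xs, r, obs @ [ob])"
  have "x \<in> span (history_vectors (xs, r, obs @ [ob]))"
    unfolding x_def using A unfolding PIFO_def by blast
  then have x: "x \<in> E k'" using span_minimal[OF hist subspace_E] by auto
  then have "proj (feasible P) x = x"
    using zc E_mono[OF kk'(2)] by (auto simp: zero_chain_def intro!: proj_E)
  then have "run n A P \<omega> s (Suc t) = (xs @ [x], r, obs @ [ob])"
    by (simp add: h Let_def x_def ob_def)
  then show ?case using x hist by (auto simp: k'_def)
qed

lemma iterate_support:
  assumes "zero_chain n I P" "A \<in> PIFO c n" "Suc (progress I s t) \<le> dimen P"
  shows "iterate n A P \<omega> s t \<in> E (Suc (progress I s t))"
proof -
  obtain xs r obs where h: "run n A P \<omega> s t = (xs, r, obs)" by (cases "run n A P \<omega> s t")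
  then show ?thesis
    using run_support[OF assms, of \<omega>] unfolding iterate_def by (auto dest: last_in_set)
qed

section \<open>Sampling is slow\<close>

text \<open>
  An algorithm commits to its sampling distribution before the problem is chosen, so the problem may
  hide its two relevant components at these indices.
\<close>

lemma two_unlikely_indices:
  fixes p :: "nat pmf" and n :: nat
  assumes "n \<ge> 2"
  obtains i j where "i \<in> {1..n}" "j \<in> {1..n}" "i \<noteq> j" "pmf p i \<le> 2 / n" "pmf p j \<le> 2 / n"
proof -
  define B where "B = {i \<in> {1..n}. pmf p i > 2 / n}"
  define C where "C = {1..n} - B"
  have fin: "finite B" "finite C" by (auto simp: B_def C_def)
  have "2 * card B < n"
  proof (cases "B = {}")
    case False
    have "real (card B) * (2 / n) = (\<Sum>i\<in>B. 2 / n)" by simp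
    also have "\<dots> < (\<Sum>i\<in>B. pmf p i)"
      using fin False by (intro sum_strict_mono) (auto simp: B_def)
    also have "\<dots> \<le> 1" by (simp add: fin flip: measure_measure_pmf_finite)
    finally have "real (2 * card B) < real n" using assms by (simp add: field_simps)
    then show ?thesis by linarith
  qed (use assms in auto)
  moreover have "card C = n - card B"
    unfolding C_def by (subst card_Diff_subset) (auto simp: B_def)
  ultimately have "card C \<ge> 2" using assms by linarith
  then obtain i j where "i \<in> C" "j \<in> C" "i \<noteq> j"
    by (metis card_le_Suc0_iff_eq[OF fin(2)] not_less_eq_eq numeral_2_eq_2)
  then show thesis using that[of i j] by (auto simp: C_def B_def)
qed

text \<open>
  Only a constant success probability is needed, so Markov's inequality can replace a concentration
  bound for the progress count.
\<close>

lemma prob_progress: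
  assumes A: "A \<in> PIFO c n" and "n > 0"
    and pI: "measure_pmf.prob (index_dist A) I \<le> b / n"
    and m: "m > 0"
  shows "measure_pmf.prob (sample_pmf A T) {s. m \<le> progress I s T} \<le> T * ((b + c) / n) / m"
proof -
  let ?bad = "{z :: nat \<times> bool. fst z \<in> I \<or> snd z}"
  let ?S = "measure_pmf (sample_pmf A T)"
  let ?p = "pair_pmf (index_dist A) (bernoulli_pmf (full_prob A))"
  have q: "0 \<le> full_prob A" "full_prob A \<le> 1" "full_prob A \<le> c / n"
    using A by (auto simp: PIFO_def)
  have count: "real (progress I s T) = (\<Sum>j=1..T. indicator {s. s j \<in> ?bad} s)" for s
  proof -
    have "real (progress I s T) = (\<Sum>j\<in>{j\<in>{1..T}. fst (s j) \<in> I \<or> snd (s j)}. 1)"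
      by (simp add: progress_def)
    also have "\<dots> = (\<Sum>j=1..T. if fst (s j) \<in> I \<or> snd (s j) then 1 else 0)"
      by (subst sum.inter_filter) auto
    also have "\<dots> = (\<Sum>j=1..T. indicator {s. s j \<in> ?bad} s)"
      by (intro sum.cong) (auto simp: indicator_def)
    finally show ?thesis .
  qed
  have step: "measure_pmf.prob (sample_pmf A T) {s. s j \<in> ?bad} \<le> (b + c) / n"
    if "j \<in> {1..T}" for j
  proof -
    have "map_pmf (\<lambda>s. s j) (sample_pmf A T) = ?p"
      using that unfolding sample_pmf_def by (subst Pi_pmf_component) auto
    then have "measure_pmf.prob (sample_pmf A T) {s. s j \<in> ?bad} = measure_pmf.prob ?p ?bad"
      using measure_map_pmf[of "\<lambda>s. s j" "sample_pmf A T" ?bad] by (simp only: vimage_def)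
    also have "\<dots> \<le> measure_pmf.prob ?p {z. fst z \<in> I} + measure_pmf.prob ?p {z. snd z}"
      using measure_Un_le[of "{z. fst z \<in> I}" "measure_pmf ?p" "{z. snd z}"]
      by (simp add: Collect_disj_eq)
    also have "measure_pmf.prob ?p {z. fst z \<in> I} = measure_pmf.prob (index_dist A) I"
      using measure_map_pmf[of fst ?p I] by (simp add: map_fst_pair_pmf vimage_def)
    also have "measure_pmf.prob ?p {z. snd z} = full_prob A"
      using measure_map_pmf[of snd ?p "{True}"] q
      by (simp add: map_snd_pair_pmf vimage_def measure_pmf_single)
    finally show ?thesis using pI q by (simp add: add_divide_distrib)
  qed
  have "measure_pmf.prob (sample_pmf A T) {s \<in> space ?S. real (progress I s T) \<ge> m}
      \<le> measure_pmf.expectation (sample_pmf A T) (\<lambda>s. real (progress I s T)) / m"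
    unfolding count using m
    by (intro integral_Markov_inequality_measure[where A = "{}"] Bochner_Integration.integrable_sum)
       (auto intro!: sum_nonneg measure_pmf.integrable_const_bound[where B = 1])
  also have "measure_pmf.expectation (sample_pmf A T) (\<lambda>s. real (progress I s T)) =
      (\<Sum>j=1..T. measure_pmf.prob (sample_pmf A T) {s. s j \<in> ?bad})"
    unfolding count
    by (subst Bochner_Integration.integral_sum)
       (auto intro!: measure_pmf.integrable_const_bound[where B = 1])
  also have "\<dots> \<le> (\<Sum>j=1..T. (b + c) / n)" by (intro sum_mono step)
  finally show ?thesis using m by (simp add: divide_right_mono)
qed

text \<open>
  With probability at least one half the last coordinate is still unknown at time \<open>T\<close>. The
  estimate holds for every value of the seed, so integrating over the seed preserves it.
\<close>

lemma expected_grad_norm_lower_bound: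
  assumes zc: "zero_chain n I P" and A: "A \<in> PIFO c n"
    and pI: "measure_pmf.prob (index_dist A) I \<le> b / n"
    and d: "dimen P \<ge> 2" and \<epsilon>: "\<epsilon> > 0"
    and grad: "\<And>x. x \<in> E (dimen P - 1) \<Longrightarrow>
      norm (grad (dimen P) (objective n P) x) \<ge> 2 * \<epsilon>"
    and T: "2 * real T * (b + c) \<le> n * real (dimen P - 1)"
  shows "expected_grad_norm n A P T \<ge> ennreal \<epsilon>"
proof -
  let ?m = "dimen P - 1"
  let ?S = "sample_pmf A T"
  define N where "N = {s. \<not> ?m \<le> progress I s T}"
  have n: "n > 0" using zc by (simp add: zero_chain_def)
  have "measure_pmf.prob ?S {s. ?m \<le> progress I s T} \<le> T * ((b + c) / n) / ?m"
    using d by (intro prob_progress[OF A n pI]) auto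
  also have "\<dots> \<le> 1 / 2" using T n d by (simp add: field_simps)
  finally have "measure_pmf.prob ?S N \<ge> 1 / 2"
    using measure_pmf.prob_compl[of "{s. ?m \<le> progress I s T}" ?S]
    by (simp add: N_def Compl_eq_Diff_UNIV[symmetric] Collect_neg_eq)
  then have "ennreal \<epsilon> \<le> ennreal (2 * \<epsilon> * measure_pmf.prob ?S N)"
    using \<epsilon> by (intro ennreal_leI) simp
  also have "\<dots> = (\<integral>\<^sup>+s. ennreal (2 * \<epsilon>) * indicator N s \<partial>measure_pmf ?S)"
    using \<epsilon> by (simp add: nn_integral_cmult ennreal_mult' measure_pmf.emeasure_eq_measure)
  finally have half: "ennreal \<epsilon> \<le> \<dots>" .
  have "(\<integral>\<^sup>+s. ennreal (2 * \<epsilon>) * indicator N s \<partial>measure_pmf ?S) \<le>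
      (\<integral>\<^sup>+s. ennreal (norm (grad (dimen P) (objective n P) (iterate n A P \<omega> s T)))
         \<partial>measure_pmf ?S)" for \<omega>
  proof (rule nn_integral_mono)
    fix s
    show "ennreal (2 * \<epsilon>) * indicator N s \<le>
        ennreal (norm (grad (dimen P) (objective n P) (iterate n A P \<omega> s T)))"
    proof (cases "s \<in> N")
      case True
      then have "Suc (progress I s T) \<le> ?m" by (auto simp: N_def)
      then have "iterate n A P \<omega> s T \<in> E ?m"
        using iterate_support[OF zc A, of s T \<omega>] E_mono by fastforce
      then show ?thesis using grad \<epsilon> True by (simp add: ennreal_leI)
    qed simp
  qed
  with half have "ennreal \<epsilon> \<le>
      (\<integral>\<^sup>+s. ennreal (norm (grad (dimen P) (objective n P) (iterate n A P \<omega> s T)))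
         \<partial>measure_pmf ?S)" for \<omega>
    by (rule order_trans)
  then have "(\<integral>\<^sup>+\<omega>. ennreal \<epsilon> \<partial>seed_dist A) \<le> expected_grad_norm n A P T"
    unfolding expected_grad_norm_def by (intro nn_integral_mono)
  moreover have "emeasure (seed_dist A) (space (seed_dist A)) = 1"
    using A by (auto simp: PIFO_def intro: prob_space.emeasure_space_1)
  ultimately show ?thesis by simp
qed

lemma hitting_time_lower_bound:
  assumes "zero_chain n I P" "A \<in> PIFO c n"
    "measure_pmf.prob (index_dist A) I \<le> b / n"
    "dimen P \<ge> 2" "\<epsilon> > 0" "b + c > 0"
    "\<And>x. x \<in> E (dimen P - 1) \<Longrightarrow> norm (grad (dimen P) (objective n P) x) \<ge> 2 * \<epsilon>"
  shows "ereal (n * real (dimen P - 1) / (2 * (b + c))) \<le> ereal_of_enat (hitting_time n A P \<epsilon>)"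
proof (cases "hitting_time n A P \<epsilon>")
  case (enat t)
  define M where "M = {enat T | T. expected_grad_norm n A P T < ennreal \<epsilon>}"
  have "M \<noteq> {}" using enat by (auto simp: hitting_time_def M_def Inf_enat_def split: if_splits)
  then have "Inf M \<in> M" by (metis wellorder_InfI ex_in_conv)
  then have "expected_grad_norm n A P t < ennreal \<epsilon>"
    using enat by (auto simp: hitting_time_def M_def)
  then have "\<not> 2 * real t * (b + c) \<le> n * real (dimen P - 1)"
    using expected_grad_norm_lower_bound[OF assms(1-5), of t] assms(7) by (meson not_less)
  then show ?thesis using assms(6) by (simp add: enat field_simps)
qed simp

section \<open>Chain functions\<close>

text \<open>
  The set \<open>R\<close> selects which neighbouring coordinates are coupled. Both components and their average
  are of this form, which lets them share all estimates.
\<close>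

definition chain ::
  "nat \<Rightarrow> (nat \<Rightarrow> real \<Rightarrow> real) \<Rightarrow> nat set \<Rightarrow> real \<Rightarrow> rvec \<Rightarrow> real" where
  "chain d \<phi> R \<kappa> x =
     \<kappa> * ((\<Sum>l<d. \<phi> l (coord x l)) + 1 / 2 * (\<Sum>l\<in>R. (coord x l - coord x (Suc l))\<^sup>2))"

definition chain_grad ::
  "nat \<Rightarrow> (nat \<Rightarrow> real \<Rightarrow> real) \<Rightarrow> nat set \<Rightarrow> real \<Rightarrow> rvec \<Rightarrow> rvec" where
  "chain_grad d \<phi>' R \<kappa> x =
     \<kappa> *\<^sub>R ((\<Sum>l<d. \<phi>' l (coord x l) *\<^sub>R unit_vec l)
          + (\<Sum>l\<in>R. (coord x l - coord x (Suc l)) *\<^sub>R (unit_vec l - unit_vec (Suc l))))"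

lemma inner_chain_grad:
  "inner (chain_grad d \<phi>' R \<kappa> x) h =
     \<kappa> * ((\<Sum>l<d. \<phi>' l (coord x l) * coord h l)
        + (\<Sum>l\<in>R. (coord x l - coord x (Suc l)) * (coord h l - coord h (Suc l))))"
  by (simp add: chain_grad_def inner_add_left inner_sum_left inner_diff_left)

lemma chain_has_derivative:
  assumes "\<And>l t. l < d \<Longrightarrow> (\<phi> l has_real_derivative \<phi>' l t) (at t)"
  shows "(chain d \<phi> R \<kappa> has_derivative inner (chain_grad d \<phi>' R \<kappa> x)) (at x)"
proof -
  have site: "((\<lambda>x. \<phi> l (coord x l)) has_derivative (\<lambda>h. \<phi>' l (coord x l) * coord h l)) (at x)"
    if "l < d" for l
    using has_derivative_compose[OF has_derivative_coord
        assms[OF that, THEN has_field_derivative_imp_has_derivative]] by simp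
  have row: "((\<lambda>x. (coord x l - coord x (Suc l))\<^sup>2) has_derivative
      (\<lambda>h. 2 * ((coord x l - coord x (Suc l)) * (coord h l - coord h (Suc l))))) (at x)" for l
    by (auto intro!: derivative_eq_intros simp: fun_eq_iff)
  have sites: "((\<lambda>x. \<Sum>l<d. \<phi> l (coord x l)) has_derivative
      (\<lambda>h. \<Sum>l<d. \<phi>' l (coord x l) * coord h l)) (at x)"
    by (intro has_derivative_sum site) simp
  have rows: "((\<lambda>x. \<Sum>l\<in>R. (coord x l - coord x (Suc l))\<^sup>2) has_derivative
      (\<lambda>h. \<Sum>l\<in>R. 2 * ((coord x l - coord x (Suc l)) * (coord h l - coord h (Suc l))))) (at x)"
    by (intro has_derivative_sum row)
  show ?thesis
    unfolding chain_def[abs_def] inner_chain_grad[abs_def]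
    using has_derivative_mult_right[OF has_derivative_add[OF sites
        has_derivative_mult_right[OF rows, of "1 / 2"]], of \<kappa>]
    by (simp flip: sum_distrib_left)
qed

lemma chain_grad_in_E:
  assumes "R \<subseteq> {l. Suc l < d}"
  shows "chain_grad d \<phi>' R \<kappa> x \<in> E d"
  unfolding chain_grad_def using assms
  by (intro subspace_mul[OF subspace_E] subspace_add[OF subspace_E] subspace_sum[OF subspace_E]
      subspace_diff[OF subspace_E] unit_in_E) auto

lemma chain_preserves:
  assumes deriv: "\<And>l t. l < d \<Longrightarrow> (\<phi> l has_real_derivative \<phi>' l t) (at t)"
    and stationary: "\<And>l. k \<le> l \<Longrightarrow> l < d \<Longrightarrow> \<phi>' l 0 = 0"
    and rows: "k \<notin> Suc ` R"
  shows "preserves k (chain d \<phi> R \<kappa>)"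
  unfolding preserves_def
proof
  fix y assume y: "y \<in> E k"
  have sites: "\<phi>' l (coord y l) *\<^sub>R unit_vec l \<in> E k" if "l < d" for l
    using y stationary[of l] that
    by (cases "l < k") (auto simp: E_def)
  have rows: "(coord y l - coord y (Suc l)) *\<^sub>R (unit_vec l - unit_vec (Suc l)) \<in> E k" if "l \<in> R" for l
  proof (cases "Suc l < k")
    case False
    with that rows have "k \<le> l" by (metis image_eqI le_neq_implies_less not_less_eq_eq not_le)
    then show ?thesis using y by (auto simp: E_def)
  qed (auto simp: E_def)
  have "(\<Sum>l<d. \<phi>' l (coord y l) *\<^sub>R unit_vec l) \<in> E k"
    by (rule subspace_sum[OF subspace_E]) (simp add: sites)
  moreover have "(\<Sum>l\<in>R. (coord y l - coord y (Suc l)) *\<^sub>R (unit_vec l - unit_vec (Suc l))) \<in> E k"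
    by (rule subspace_sum[OF subspace_E]) (simp add: rows)
  ultimately have "chain_grad d \<phi>' R \<kappa> y \<in> E k"
    unfolding chain_grad_def
    by (intro subspace_mul[OF subspace_E] subspace_add[OF subspace_E])
  then show "\<exists>G\<in>E k. (chain d \<phi> R \<kappa> has_derivative inner G) (at y)"
    using chain_has_derivative[of d \<phi> \<phi>', OF deriv] by blast
qed

lemma row_differences_le:
  assumes "R \<subseteq> {l. Suc l < d}" "v \<in> E d"
  shows "L2_set (\<lambda>l. coord v l - coord v (Suc l)) R \<le> 2 * norm v"
proof -
  have "(\<Sum>l\<in>R. (coord v l)\<^sup>2) \<le> (\<Sum>l<d. (coord v l)\<^sup>2)"
    using assms(1) by (intro sum_mono2) auto
  moreover have "(\<Sum>l\<in>R. (coord v (Suc l))\<^sup>2) = (\<Sum>l\<in>Suc ` R. (coord v l)\<^sup>2)"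
    by (subst sum.reindex) auto
  moreover have "\<dots> \<le> (\<Sum>l<d. (coord v l)\<^sup>2)"
    using assms(1) by (intro sum_mono2) auto
  moreover have "(\<Sum>l\<in>R. (coord v l - coord v (Suc l))\<^sup>2)
      \<le> (\<Sum>l\<in>R. 2 * (coord v l)\<^sup>2 + 2 * (coord v (Suc l))\<^sup>2)"
    by (intro sum_mono) (use sum_squares_bound in \<open>smt (verit) power2_diff power2_sum zero_le_power2\<close>)
  ultimately have "(\<Sum>l\<in>R. (coord v l - coord v (Suc l))\<^sup>2) \<le> (2 * norm v)\<^sup>2"
    unfolding power_mult_distrib norm_square_E[OF assms(2)] sum.distrib sum_distrib_left[symmetric]
    by simp
  then show ?thesis unfolding L2_set_def by (intro real_le_lsqrt) (auto intro: sum_nonneg)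
qed

text \<open>
  The estimate is tested against the difference of the gradients itself; the coupling contributes
  the square of the factor \<open>2\<close> from \<open>row_differences_le\<close>.
\<close>

lemma chain_grad_lipschitz:
  assumes R: "R \<subseteq> {l. Suc l < d}" and "\<kappa> \<ge> 0" and xy: "x \<in> E d" "y \<in> E d"
    and lip: "\<And>l s t. \<bar>\<phi>' l s - \<phi>' l t\<bar> \<le> K * \<bar>s - t\<bar>"
  shows "norm (chain_grad d \<phi>' R \<kappa> x - chain_grad d \<phi>' R \<kappa> y) \<le> \<kappa> * (K + 4) * norm (x - y)"
proof -
  define v where "v = x - y"
  define h where "h = chain_grad d \<phi>' R \<kappa> x - chain_grad d \<phi>' R \<kappa> y"
  have vE: "v \<in> E d" unfolding v_def using xy by (rule subspace_diff[OF subspace_E])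
  have hE: "h \<in> E d"
    unfolding h_def using chain_grad_in_E[OF R] by (intro subspace_diff[OF subspace_E])
  have K: "K \<ge> 0" using lip[of 0 1 0] by auto
  have "(\<Sum>l<d. (\<phi>' l (coord x l) - \<phi>' l (coord y l)) * coord h l)
      \<le> (\<Sum>l<d. K * (\<bar>coord v l\<bar> * \<bar>coord h l\<bar>))"
  proof (rule sum_mono)
    fix l
    have "(\<phi>' l (coord x l) - \<phi>' l (coord y l)) * coord h l
        \<le> \<bar>\<phi>' l (coord x l) - \<phi>' l (coord y l)\<bar> * \<bar>coord h l\<bar>"
      by (metis abs_ge_self abs_mult)
    also have "\<dots> \<le> K * \<bar>coord v l\<bar> * \<bar>coord h l\<bar>"
      using lip[of l "coord x l" "coord y l"] by (intro mult_right_mono) (auto simp: v_def)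
    finally show "(\<phi>' l (coord x l) - \<phi>' l (coord y l)) * coord h l
        \<le> K * (\<bar>coord v l\<bar> * \<bar>coord h l\<bar>)" by (simp add: mult.assoc)
  qed
  also have "\<dots> \<le> K * (norm v * norm h)"
    unfolding sum_distrib_left[symmetric] norm_E[OF vE] norm_E[OF hE]
    by (intro mult_left_mono L2_set_mult_ineq K)
  finally have sites: "(\<Sum>l<d. (\<phi>' l (coord x l) - \<phi>' l (coord y l)) * coord h l)
      \<le> K * (norm v * norm h)" .
  have "(\<Sum>l\<in>R. (coord v l - coord v (Suc l)) * (coord h l - coord h (Suc l)))
      \<le> (\<Sum>l\<in>R. \<bar>coord v l - coord v (Suc l)\<bar> * \<bar>coord h l - coord h (Suc l)\<bar>)"
    by (intro sum_mono) (metis abs_ge_self abs_mult)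
  also have "\<dots> \<le> L2_set (\<lambda>l. coord v l - coord v (Suc l)) R
      * L2_set (\<lambda>l. coord h l - coord h (Suc l)) R"
    by (rule L2_set_mult_ineq)
  also have "\<dots> \<le> (2 * norm v) * (2 * norm h)"
    by (intro mult_mono row_differences_le[OF R] vE hE) auto
  finally have rows: "(\<Sum>l\<in>R. (coord v l - coord v (Suc l)) * (coord h l - coord h (Suc l)))
      \<le> 4 * (norm v * norm h)" by simp
  have "(norm h)\<^sup>2 = inner (chain_grad d \<phi>' R \<kappa> x) h - inner (chain_grad d \<phi>' R \<kappa> y) h"
    by (simp add: power2_norm_eq_inner h_def inner_diff_left)
  also have "\<dots> = \<kappa> * ((\<Sum>l<d. (\<phi>' l (coord x l) - \<phi>' l (coord y l)) * coord h l)
      + (\<Sum>l\<in>R. (coord v l - coord v (Suc l)) * (coord h l - coord h (Suc l))))"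
    unfolding inner_chain_grad v_def
    by (simp add: algebra_simps sum_subtractf sum.distrib)
  also have "\<dots> \<le> \<kappa> * (K * (norm v * norm h) + 4 * (norm v * norm h))"
    using sites rows \<open>\<kappa> \<ge> 0\<close> by (intro mult_left_mono add_mono)
  also have "\<dots> = (\<kappa> * (K + 4) * norm v) * norm h" by (simp add: algebra_simps)
  finally have "norm h * norm h \<le> (\<kappa> * (K + 4) * norm v) * norm h"
    by (simp add: power2_eq_square)
  then have "norm h \<le> \<kappa> * (K + 4) * norm v"
    using K \<open>\<kappa> \<ge> 0\<close> by (cases "norm h = 0") auto
  then show ?thesis by (simp add: h_def v_def)
qed

lemma convex_on_coord:
  assumes "convex_on UNIV g" "convex S"
  shows "convex_on S (\<lambda>x. g (coord x l))"
  using assms(2) convex_onD[OF assms(1)] by (intro convex_onI) auto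

lemma convex_on_sum_functions:
  assumes "convex S" "\<And>l. l \<in> A \<Longrightarrow> convex_on S (f l)"
  shows "convex_on S (\<lambda>x. \<Sum>l\<in>A. f l x :: real)"
  using assms(2)
  by (induction A rule: infinite_finite_induct) (auto simp: convex_on_const assms(1) intro!: convex_on_add)

lemma convex_on_square: "convex_on UNIV (\<lambda>t::real. t\<^sup>2)"
  by (rule convex_on_realI[where f' = "\<lambda>t. 2 * t"]) (auto intro!: derivative_eq_intros)

lemma chain_weakly_convex:
  assumes "\<kappa> > 0" "\<And>l. convex_on UNIV (\<lambda>t. \<phi> l t + \<mu> / (2 * \<kappa>) * t\<^sup>2)"
  shows "weakly_convex_on (E d) \<mu> (chain d \<phi> R \<kappa>)"
proof -
  have row: "convex_on (E d) (\<lambda>x. (coord x l - coord x (Suc l))\<^sup>2)" for l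
  proof (rule convex_onI[OF _ convex_E])
    fix t :: real and x y assume t: "0 < t" "t < 1"
    show "(coord ((1 - t) *\<^sub>R x + t *\<^sub>R y) l - coord ((1 - t) *\<^sub>R x + t *\<^sub>R y) (Suc l))\<^sup>2
        \<le> (1 - t) * (coord x l - coord x (Suc l))\<^sup>2 + t * (coord y l - coord y (Suc l))\<^sup>2"
      using convex_onD[OF convex_on_square, of t "coord x l - coord x (Suc l)"
          "coord y l - coord y (Suc l)"] t
      by (simp add: algebra_simps)
  qed
  have sites: "convex_on (E d) (\<lambda>x. \<Sum>l<d. \<phi> l (coord x l) + \<mu> / (2 * \<kappa>) * (coord x l)\<^sup>2)"
    by (intro convex_on_sum_functions convex_E convex_on_coord[OF assms(2) convex_E])
  have rows: "convex_on (E d) (\<lambda>x. \<Sum>l\<in>R. (coord x l - coord x (Suc l))\<^sup>2)"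
    by (intro convex_on_sum_functions convex_E row)
  have cvx: "convex_on (E d) (\<lambda>x. \<kappa> * ((\<Sum>l<d. \<phi> l (coord x l) + \<mu> / (2 * \<kappa>) * (coord x l)\<^sup>2)
      + 1 / 2 * (\<Sum>l\<in>R. (coord x l - coord x (Suc l))\<^sup>2)))"
    using \<open>\<kappa> > 0\<close> by (intro convex_on_cmul[OF _ convex_on_add[OF sites convex_on_cmul[OF _ rows]]]) auto
  have eq: "\<kappa> * ((\<Sum>l<d. \<phi> l (coord x l) + \<mu> / (2 * \<kappa>) * (coord x l)\<^sup>2)
      + 1 / 2 * (\<Sum>l\<in>R. (coord x l - coord x (Suc l))\<^sup>2)) = chain d \<phi> R \<kappa> x + \<mu> / 2 * (norm x)\<^sup>2"
    if "x \<in> E d" for x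
    unfolding chain_def norm_square_E[OF that] sum.distrib sum_distrib_left[symmetric]
    using \<open>\<kappa> > 0\<close> by (simp add: field_simps)
  show ?thesis
    unfolding weakly_convex_on_def
  proof (rule convex_onI[OF _ convex_E])
    fix t :: real and x y assume t: "0 < t" "t < 1" and xy: "x \<in> E d" "y \<in> E d"
    then have z: "(1 - t) *\<^sub>R x + t *\<^sub>R y \<in> E d"
      by (intro subspace_add[OF subspace_E] subspace_mul[OF subspace_E])
    show "chain d \<phi> R \<kappa> ((1 - t) *\<^sub>R x + t *\<^sub>R y) + \<mu> / 2 * (norm ((1 - t) *\<^sub>R x + t *\<^sub>R y))\<^sup>2
        \<le> (1 - t) * (chain d \<phi> R \<kappa> x + \<mu> / 2 * (norm x)\<^sup>2)
          + t * (chain d \<phi> R \<kappa> y + \<mu> / 2 * (norm y)\<^sup>2)"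
      using convex_onD[OF cvx, of t x y] t xy
      unfolding eq[OF z] eq[OF xy(1)] eq[OF xy(2)] by simp
  qed
qed

section \<open>The gradient cannot be small before the chain is completed\<close>

text \<open>
  The derivative of this potential is \<open>t\<close> minus four times \<open>t\<close> clamped to the interval from \<open>0\<close> to
  \<open>\<sigma>/4\<close>: it is \<open>t\<close> to the left, \<open>- 3 * t\<close> in the middle and \<open>t - \<sigma>\<close> to the right. So \<open>0\<close> is
  stationary, \<open>\<sigma>\<close> is the minimum, and, apart from a bounded correction of fixed sign, the
  derivative is linear. The correction attains its full size \<open>\<sigma>\<close> already at \<open>\<sigma>/4\<close>.
\<close>

definition well :: "real \<Rightarrow> real \<Rightarrow> real" where
  "well \<sigma> t = t\<^sup>2 / 2 - 2 * ((max 0 t)\<^sup>2 - (max 0 (t - \<sigma> / 4))\<^sup>2)"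

definition well' :: "real \<Rightarrow> real \<Rightarrow> real" where
  "well' \<sigma> t = t - 4 * (max 0 t - max 0 (t - \<sigma> / 4))"

lemma DERIV_max_0_square: "((\<lambda>t::real. (max 0 t)\<^sup>2) has_real_derivative 2 * max 0 t) (at t)"
proof -
  consider "t > 0" | "t < 0" | "t = 0" by linarith
  then show ?thesis
  proof cases
    case 1
    have "((\<lambda>t::real. t\<^sup>2) has_real_derivative 2 * t) (at t)"
      by (auto intro!: derivative_eq_intros)
    then have "((\<lambda>t::real. (max 0 t)\<^sup>2) has_real_derivative 2 * t) (at t)"
      by (rule has_field_derivative_transform_within_open[of _ _ _ "{0<..}"]) (use 1 in auto)
    with 1 show ?thesis by simp
  next
    case 2
    have "((\<lambda>t::real. 0) has_real_derivative 0) (at t)" by simp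
    then have "((\<lambda>t::real. (max 0 t)\<^sup>2) has_real_derivative 0) (at t)"
      by (rule has_field_derivative_transform_within_open[of _ _ _ "{..<0}"]) (use 2 in auto)
    with 2 show ?thesis by simp
  next
    case 3
    have "((\<lambda>h::real. (max 0 h)\<^sup>2 / h) \<longlongrightarrow> 0) (at 0)"
    proof (rule Lim_null_comparison)
      show "\<forall>\<^sub>F h in at 0. norm ((max 0 h)\<^sup>2 / h) \<le> \<bar>h\<bar>" for h :: real
        by (auto simp: max_def power2_eq_square)
      show "((\<lambda>h::real. \<bar>h\<bar>) \<longlongrightarrow> 0) (at 0)"
        using tendsto_rabs_zero[OF tendsto_ident_at[of "0::real" UNIV]] by simp
    qed
    with 3 show ?thesis by (simp add: has_field_derivative_iff)
  qed
qed

lemma DERIV_well: "(well \<sigma> has_real_derivative well' \<sigma> t) (at t)"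
proof -
  have "((\<lambda>t. (max 0 (t - \<sigma> / 4))\<^sup>2) has_real_derivative 2 * max 0 (t - \<sigma> / 4)) (at t)"
  proof -
    have "((\<lambda>t. t - \<sigma> / 4) has_real_derivative 1) (at t)"
      by (auto intro!: derivative_eq_intros)
    from DERIV_chain2[OF DERIV_max_0_square this] show ?thesis by simp
  qed
  note diff = DERIV_diff[OF DERIV_max_0_square this]
  have "((\<lambda>t::real. t\<^sup>2 / 2) has_real_derivative t) (at t)"
    by (auto intro!: derivative_eq_intros)
  from DERIV_diff[OF this DERIV_cmult[OF diff, of 2]] show ?thesis
    unfolding well_def[abs_def] well'_def by (simp add: algebra_simps)
qed

lemma well'_lipschitz: "\<sigma> \<ge> 0 \<Longrightarrow> \<bar>well' \<sigma> s - well' \<sigma> t\<bar> \<le> 3 * \<bar>s - t\<bar>"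
  by (auto simp: well'_def max_def abs_if split: if_splits)

lemma well_lower_bound: "\<sigma> \<ge> 0 \<Longrightarrow> well \<sigma> t \<ge> - (3 / 8) * \<sigma>\<^sup>2"
proof -
  assume \<sigma>: "\<sigma> \<ge> 0"
  consider "t \<le> 0" | "0 < t" "t \<le> \<sigma> / 4" | "t > \<sigma> / 4" by linarith
  then show ?thesis
  proof cases
    case 1
    then have "well \<sigma> t = t\<^sup>2 / 2" using \<sigma> by (simp add: well_def max_def)
    then show ?thesis using zero_le_power2[of t] zero_le_power2[of \<sigma>] by linarith
  next
    case 2
    then have "t\<^sup>2 \<le> (\<sigma> / 4)\<^sup>2" by (intro power_mono) auto
    then have "16 * t\<^sup>2 \<le> \<sigma>\<^sup>2" by (simp add: power_divide)
    moreover have "well \<sigma> t = - (3 / 2) * t\<^sup>2" using 2 by (simp add: well_def max_def)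
    ultimately show ?thesis using zero_le_power2[of \<sigma>] by linarith
  next
    case 3
    then have "well \<sigma> t = (t - \<sigma>)\<^sup>2 / 2 - 3 / 8 * \<sigma>\<^sup>2"
      using \<sigma> by (simp add: well_def max_def power2_eq_square field_simps)
    then show ?thesis by simp
  qed
qed

lemma well_0 [simp]: "\<sigma> \<ge> 0 \<Longrightarrow> well \<sigma> 0 = 0"
  by (simp add: well_def)

lemma well'_0 [simp]: "\<sigma> \<ge> 0 \<Longrightarrow> well' \<sigma> 0 = 0"
  by (simp add: well'_def)

text \<open>
  With ratio \<open>1 - \<tau>\<close> the second differences of this sequence equal \<open>\<tau>\<^sup>2/(1-\<tau>)\<close> times the sequence
  away from the peak \<open>p\<close>, and the boundary weight \<open>\<tau>\<close> extends this to the left end.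
\<close>

definition bump :: "real \<Rightarrow> nat \<Rightarrow> nat \<Rightarrow> real" where
  "bump \<tau> p l = (1 - \<tau>) ^ (if l \<le> p then p - l else l - p)"

lemma bump_peak [simp]: "bump \<tau> p p = 1"
  by (simp add: bump_def)

lemma bump_left: "l < p \<Longrightarrow> bump \<tau> p l = (1 - \<tau>) * bump \<tau> p (Suc l)"
  by (simp add: bump_def Suc_diff_Suc flip: power_Suc)

lemma bump_right: "p \<le> l \<Longrightarrow> bump \<tau> p (Suc l) = (1 - \<tau>) * bump \<tau> p l"
  by (auto simp: bump_def Suc_diff_le)

lemma bump_nonneg: "\<tau> \<le> 1 \<Longrightarrow> bump \<tau> p l \<ge> 0"
  by (simp add: bump_def)

lemma sum_bump_square:
  assumes "0 < \<tau>" "\<tau> \<le> 1"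
  shows "\<tau> * (\<Sum>l<d. (bump \<tau> p l)\<^sup>2) \<le> 2"
proof -
  let ?w = "bump \<tau> p"
  have left: "\<tau> * (\<Sum>l<k. (?w l)\<^sup>2) \<le> (?w k)\<^sup>2" if "k \<le> p" for k
    using that
  proof (induction k)
    case (Suc k)
    have "(1 + \<tau>) * (1 - \<tau>)\<^sup>2 = (1 - \<tau>) - \<tau>\<^sup>2 * (1 - \<tau>)" by (simp add: power2_eq_square algebra_simps)
    also have "\<dots> \<le> 1"
      using assms mult_nonneg_nonneg[OF zero_le_power2[of \<tau>], of "1 - \<tau>"] by linarith
    finally have "(1 + \<tau>) * (1 - \<tau>)\<^sup>2 * (?w (Suc k))\<^sup>2 \<le> 1 * (?w (Suc k))\<^sup>2"
      by (rule mult_right_mono) simp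
    moreover have "?w k = (1 - \<tau>) * ?w (Suc k)" using Suc.prems by (intro bump_left) simp
    moreover have "\<tau> * (\<Sum>l<Suc k. (?w l)\<^sup>2) \<le> (1 + \<tau>) * (?w k)\<^sup>2"
      using Suc by (simp add: algebra_simps)
    ultimately show ?case by (simp add: power_mult_distrib mult.assoc)
  qed simp
  have right: "\<tau> * (\<Sum>l<k. (?w l)\<^sup>2) \<le> 2 - (?w k)\<^sup>2" if "p \<le> k" for k
    using that
  proof (induction k rule: dec_induct)
    case base
    then show ?case using left[of p] by simp
  next
    case (step k)
    have "(1 - \<tau>)\<^sup>2 \<le> 1 - \<tau>"
      using assms by (simp add: power2_eq_square mult_left_le)
    then have "(1 - \<tau>)\<^sup>2 * (?w k)\<^sup>2 \<le> (1 - \<tau>) * (?w k)\<^sup>2" by (rule mult_right_mono) simp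
    moreover have "(?w (Suc k))\<^sup>2 = (1 - \<tau>)\<^sup>2 * (?w k)\<^sup>2"
      by (simp only: bump_right[OF step(1)] power_mult_distrib)
    ultimately show ?case using step.IH by (simp add: algebra_simps)
  qed
  have "(\<Sum>l<d. (?w l)\<^sup>2) \<le> (\<Sum>l<max d p. (?w l)\<^sup>2)" by (rule sum_mono2) auto
  then have "\<tau> * (\<Sum>l<d. (?w l)\<^sup>2) \<le> \<tau> * (\<Sum>l<max d p. (?w l)\<^sup>2)" using assms by simp
  also have "\<dots> \<le> 2" using right[of "max d p"] by (smt (verit) max.cobounded2 zero_le_power2)
  finally show ?thesis .
qed

text \<open>
  Summation by parts, in the form of a telescoping invariant. For constant \<open>x\<close> the same identity
  gives the total weight to the left of the peak.
\<close>

lemma bump_summation_left: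
  fixes x :: "nat \<Rightarrow> real"
  assumes "\<tau> < 1" "k \<le> p"
  shows "\<tau> * x 0 * bump \<tau> p 0
      + (\<Sum>l<k. (x l - x (Suc l)) * (bump \<tau> p l - bump \<tau> p (Suc l)))
      + \<tau>\<^sup>2 / (1 - \<tau>) * (\<Sum>l<k. bump \<tau> p l * x l) = \<tau> * bump \<tau> p k * x k"
  using assms(2)
proof (induction k)
  case (Suc k)
  have w: "bump \<tau> p k = (1 - \<tau>) * bump \<tau> p (Suc k)" using Suc.prems by (intro bump_left) simp
  have a: "\<tau>\<^sup>2 / (1 - \<tau>) * (bump \<tau> p k * x k) = \<tau>\<^sup>2 * bump \<tau> p (Suc k) * x k"
    unfolding w using assms(1) by simp
  have "\<tau> * x 0 * bump \<tau> p 0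
      + (\<Sum>l<Suc k. (x l - x (Suc l)) * (bump \<tau> p l - bump \<tau> p (Suc l)))
      + \<tau>\<^sup>2 / (1 - \<tau>) * (\<Sum>l<Suc k. bump \<tau> p l * x l)
    = \<tau> * bump \<tau> p k * x k + (x k - x (Suc k)) * (bump \<tau> p k - bump \<tau> p (Suc k))
      + \<tau>\<^sup>2 / (1 - \<tau>) * (bump \<tau> p k * x k)"
    using Suc by (simp add: distrib_left)
  also have "\<dots> = \<tau> * bump \<tau> p (Suc k) * x (Suc k)"
    unfolding a unfolding w by (simp add: algebra_simps power2_eq_square)
  finally show ?case .
qed simp

lemma bump_summation:
  fixes x :: "nat \<Rightarrow> real"
  assumes "\<tau> < 1" "p \<le> k"
  shows "\<tau> * x 0 * bump \<tau> p 0
      + (\<Sum>l<k. (x l - x (Suc l)) * (bump \<tau> p l - bump \<tau> p (Suc l)))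
      + \<tau>\<^sup>2 / (1 - \<tau>) * (\<Sum>l<Suc k. bump \<tau> p l * x l)
    = (2 * \<tau> + \<tau>\<^sup>2 / (1 - \<tau>)) * x p - \<tau> * bump \<tau> p k * x k"
  using assms(2)
proof (induction k rule: dec_induct)
  case base
  show ?case using bump_summation_left[OF assms(1), of p p x] by (simp add: algebra_simps)
next
  case (step k)
  have w: "bump \<tau> p (Suc k) = (1 - \<tau>) * bump \<tau> p k" using step(1) by (rule bump_right)
  have a: "\<tau>\<^sup>2 / (1 - \<tau>) * (bump \<tau> p (Suc k) * x (Suc k)) = \<tau>\<^sup>2 * bump \<tau> p k * x (Suc k)"
    unfolding w using assms(1) by simp
  have "\<tau> * x 0 * bump \<tau> p 0
      + (\<Sum>l<Suc k. (x l - x (Suc l)) * (bump \<tau> p l - bump \<tau> p (Suc l)))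
      + \<tau>\<^sup>2 / (1 - \<tau>) * (\<Sum>l<Suc (Suc k). bump \<tau> p l * x l)
    = ((2 * \<tau> + \<tau>\<^sup>2 / (1 - \<tau>)) * x p - \<tau> * bump \<tau> p k * x k)
      + (x k - x (Suc k)) * (bump \<tau> p k - bump \<tau> p (Suc k))
      + \<tau>\<^sup>2 / (1 - \<tau>) * (bump \<tau> p (Suc k) * x (Suc k))"
    unfolding step.IH[symmetric] by (simp add: distrib_left)
  also have "\<dots> = (2 * \<tau> + \<tau>\<^sup>2 / (1 - \<tau>)) * x p - \<tau> * bump \<tau> p (Suc k) * x (Suc k)"
    unfolding a unfolding w by (simp add: algebra_simps power2_eq_square)
  finally show ?case .
qed

text \<open>
  By \<open>bump_summation\<close> the linear part of the gradient contributes only a term at the peak, where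
  \<open>x p \<le> \<sigma>/4\<close> limits it to \<open>2 * \<tau> * \<sigma>/4\<close>. To the left of the peak the correction in
  \<open>well'\<close> has its full size \<open>- \<sigma>\<close>, which together with the boundary term gives exactly
  \<open>- \<tau> * \<sigma>\<close>; to the right it has the favourable sign whatever \<open>x\<close> does there.
\<close>

lemma bump_test:
  fixes x :: "nat \<Rightarrow> real"
  assumes \<tau>: "0 < \<tau>" "\<tau> < 1" and \<sigma>: "\<sigma> > 0"
    and p: "p \<le> m" "x p \<le> \<sigma> / 4" "\<And>l. l < p \<Longrightarrow> x l > \<sigma> / 4" and "x m = 0"
  shows "\<tau> * (x 0 - \<sigma>) * bump \<tau> p 0
      + (\<Sum>l<m. (x l - x (Suc l)) * (bump \<tau> p l - bump \<tau> p (Suc l)))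
      + \<tau>\<^sup>2 / (1 - \<tau>) * (\<Sum>l<Suc m. bump \<tau> p l * well' \<sigma> (x l)) \<le> - (\<tau> * \<sigma> / 2)"
proof -
  let ?w = "bump \<tau> p"
  define a where "a = \<tau>\<^sup>2 / (1 - \<tau>)"
  have "a \<ge> 0" using \<tau> by (simp add: a_def)
  define c where "c t = well' \<sigma> t - t" for t
  have c_nonpos: "c t \<le> 0" for t using \<sigma> by (simp add: c_def well'_def max_def)
  have c_right: "c t = - \<sigma>" if "t > \<sigma> / 4" for t using \<sigma> that by (simp add: c_def well'_def max_def)
  have c_left: "c t = - 4 * max 0 t" if "t \<le> \<sigma> / 4" for t
    using \<sigma> that by (simp add: c_def well'_def max_def)
  have w0: "?w l \<ge> 0" for l using \<tau> by (intro bump_nonneg) simp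
  \<comment> \<open>The linear part; \<open>x m = 0\<close> removes the remainder of the summation by parts.\<close>
  have total: "\<tau> * x 0 * ?w 0 + (\<Sum>l<m. (x l - x (Suc l)) * (?w l - ?w (Suc l)))
      + a * (\<Sum>l<Suc m. ?w l * x l) = (2 * \<tau> + a) * x p"
    using bump_summation[OF \<tau>(2) p(1), of x] \<open>x m = 0\<close> by (simp add: a_def)
  \<comment> \<open>The weights to the left of the peak amount to \<open>\<tau>\<close>, however long that part is.\<close>
  have mass: "\<tau> * ?w 0 + a * (\<Sum>l<p. ?w l) = \<tau>"
    using bump_summation_left[OF \<tau>(2) order.refl[of p], where x = "\<lambda>_. 1"] by (simp add: a_def)
  have "(\<Sum>l<Suc m. ?w l * c (x l)) \<le> (\<Sum>l<Suc p. ?w l * c (x l))"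
  proof -
    have split: "{..<Suc m} = {..<Suc p} \<union> {Suc p..<Suc m}" using p(1) by auto
    have "(\<Sum>l<Suc m. ?w l * c (x l))
        = (\<Sum>l<Suc p. ?w l * c (x l)) + (\<Sum>l\<in>{Suc p..<Suc m}. ?w l * c (x l))"
      unfolding split by (rule sum.union_disjoint) auto
    moreover have "(\<Sum>l\<in>{Suc p..<Suc m}. ?w l * c (x l)) \<le> 0"
      using w0 c_nonpos by (intro sum_nonpos mult_nonneg_nonpos) auto
    ultimately show ?thesis by linarith
  qed
  also have "\<dots> = - \<sigma> * (\<Sum>l<p. ?w l) - 4 * max 0 (x p)"
  proof -
    have "(\<Sum>l<p. ?w l * c (x l)) = (\<Sum>l<p. - \<sigma> * ?w l)"
      using p(3) by (intro sum.cong) (auto simp: c_right)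
    then show ?thesis using c_left[OF p(2)] by (simp add: sum_distrib_left)
  qed
  finally have tail: "a * (\<Sum>l<Suc m. ?w l * c (x l)) \<le> a * (- \<sigma> * (\<Sum>l<p. ?w l) - 4 * max 0 (x p))"
    using \<open>a \<ge> 0\<close> by (rule mult_left_mono)
  have "\<tau> * (x 0 - \<sigma>) * ?w 0 + (\<Sum>l<m. (x l - x (Suc l)) * (?w l - ?w (Suc l)))
      + a * (\<Sum>l<Suc m. ?w l * well' \<sigma> (x l))
    = (\<tau> * x 0 * ?w 0 + (\<Sum>l<m. (x l - x (Suc l)) * (?w l - ?w (Suc l)))
      + a * (\<Sum>l<Suc m. ?w l * x l)) - \<tau> * \<sigma> * ?w 0 + a * (\<Sum>l<Suc m. ?w l * c (x l))"
    unfolding c_def by (simp add: algebra_simps sum_subtractf sum.distrib del: sum.lessThan_Suc)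
  also have "\<dots> \<le> (2 * \<tau> + a) * x p - \<sigma> * (\<tau> * ?w 0 + a * (\<Sum>l<p. ?w l)) - 4 * a * max 0 (x p)"
    unfolding total using tail by (simp add: algebra_simps)
  also have "\<dots> \<le> 2 * \<tau> * max 0 (x p) - \<sigma> * \<tau>"
  proof -
    have "(2 * \<tau> + a) * x p \<le> (2 * \<tau> + a) * max 0 (x p)"
      using \<tau> \<open>a \<ge> 0\<close> by (intro mult_left_mono) auto
    moreover have "a * max 0 (x p) \<ge> 0" using \<open>a \<ge> 0\<close> by simp
    ultimately show ?thesis unfolding mass by (simp add: algebra_simps)
  qed
  also have "\<dots> \<le> 2 * \<tau> * (\<sigma> / 4) - \<sigma> * \<tau>"
    using p(2) \<tau> \<sigma> by (intro diff_right_mono mult_left_mono) auto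
  finally show ?thesis by (simp add: a_def mult.commute)
qed

section \<open>The hard instance\<close>

text \<open>
  The boundary term at coordinate \<open>0\<close> starts the chain. Its weight \<open>\<tau>\<close>, the square root of the weight
  of the wells up to a constant, is small enough not to dominate the gap to the infimum.
\<close>

definition site :: "real \<Rightarrow> real \<Rightarrow> nat \<Rightarrow> real \<Rightarrow> real" where
  "site \<sigma> \<tau> l t =
     (if l = 0 then \<tau> / 2 * (t - \<sigma>)\<^sup>2 else 0) + \<tau>\<^sup>2 / (1 - \<tau>) * well \<sigma> t"

definition site' :: "real \<Rightarrow> real \<Rightarrow> nat \<Rightarrow> real \<Rightarrow> real" where
  "site' \<sigma> \<tau> l t =
     (if l = 0 then \<tau> * (t - \<sigma>) else 0) + \<tau>\<^sup>2 / (1 - \<tau>) * well' \<sigma> t"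

lemma DERIV_site: "(site \<sigma> \<tau> l has_real_derivative site' \<sigma> \<tau> l t) (at t)"
proof -
  have "((\<lambda>t. if l = 0 then \<tau> / 2 * (t - \<sigma>)\<^sup>2 else 0) has_real_derivative
      (if l = 0 then \<tau> * (t - \<sigma>) else 0)) (at t)"
    by (cases "l = 0") (auto intro!: derivative_eq_intros)
  from DERIV_add[OF this DERIV_cmult[OF DERIV_well]] show ?thesis
    unfolding site_def[abs_def] site'_def .
qed

lemma well_weight_bounds:
  fixes \<tau> :: real
  assumes "0 < \<tau>" "\<tau> \<le> 1 / 2"
  shows "0 \<le> \<tau>\<^sup>2 / (1 - \<tau>)" "\<tau>\<^sup>2 / (1 - \<tau>) \<le> 2 * \<tau>\<^sup>2" "\<tau>\<^sup>2 / (1 - \<tau>) \<le> 1 / 2"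
proof -
  show "0 \<le> \<tau>\<^sup>2 / (1 - \<tau>)" using assms by simp
  have "\<tau>\<^sup>2 * 1 \<le> \<tau>\<^sup>2 * (2 * (1 - \<tau>))" using assms by (intro mult_left_mono) auto
  then show le: "\<tau>\<^sup>2 / (1 - \<tau>) \<le> 2 * \<tau>\<^sup>2" using assms by (simp add: pos_divide_le_eq mult_ac)
  have "\<tau>\<^sup>2 \<le> (1 / 2)\<^sup>2" using assms by (intro power_mono) auto
  then have "\<tau>\<^sup>2 \<le> 1 / 4" by (simp add: power_divide)
  with le show "\<tau>\<^sup>2 / (1 - \<tau>) \<le> 1 / 2" by linarith
qed

lemma site'_lipschitz:
  assumes "0 < \<tau>" "\<tau> \<le> 1 / 2" "\<sigma> \<ge> 0"
  shows "\<bar>site' \<sigma> \<tau> l s - site' \<sigma> \<tau> l t\<bar> \<le> 2 * \<bar>s - t\<bar>"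
proof -
  let ?a = "\<tau>\<^sup>2 / (1 - \<tau>)"
  have "site' \<sigma> \<tau> l s - site' \<sigma> \<tau> l t
      = (if l = 0 then \<tau> * (s - t) else 0) + ?a * (well' \<sigma> s - well' \<sigma> t)"
    by (simp add: site'_def right_diff_distrib)
  also have "\<bar>\<dots>\<bar> \<le> \<bar>if l = 0 then \<tau> * (s - t) else 0\<bar> + \<bar>?a * (well' \<sigma> s - well' \<sigma> t)\<bar>"
    by (rule abs_triangle_ineq)
  also have "\<dots> \<le> 1 / 2 * \<bar>s - t\<bar> + 1 / 2 * (3 * \<bar>s - t\<bar>)"
  proof (rule add_mono)
    show "\<bar>if l = 0 then \<tau> * (s - t) else 0\<bar> \<le> 1 / 2 * \<bar>s - t\<bar>"
      using assms(1) mult_right_mono[OF assms(2), of "\<bar>s - t\<bar>"] by (simp add: abs_mult)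
    show "\<bar>?a * (well' \<sigma> s - well' \<sigma> t)\<bar> \<le> 1 / 2 * (3 * \<bar>s - t\<bar>)"
      unfolding abs_mult abs_of_nonneg[OF well_weight_bounds(1)[OF assms(1,2)]]
      using well_weight_bounds[OF assms(1,2)] well'_lipschitz[OF assms(3)]
      by (intro mult_mono) auto
  qed
  finally show ?thesis by simp
qed

lemma site_weakly_convex:
  assumes "0 < \<tau>" "\<tau> \<le> 1 / 2" "\<sigma> \<ge> 0" "3 * (\<tau>\<^sup>2 / (1 - \<tau>)) \<le> c"
  shows "convex_on UNIV (\<lambda>t. site \<sigma> \<tau> l t + c / 2 * t\<^sup>2)"
proof (rule convex_on_realI[where f' = "\<lambda>t. site' \<sigma> \<tau> l t + c * t"])
  show "((\<lambda>t. site \<sigma> \<tau> l t + c / 2 * t\<^sup>2) has_real_derivative site' \<sigma> \<tau> l t + c * t) (at t)" for t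
    by (auto intro!: derivative_eq_intros DERIV_site)
next
  fix s t :: real assume "s \<le> t"
  let ?a = "\<tau>\<^sup>2 / (1 - \<tau>)"
  have "?a * (well' \<sigma> s - well' \<sigma> t) \<le> ?a * (3 * (t - s))"
    using well'_lipschitz[OF assms(3), of s t] \<open>s \<le> t\<close> well_weight_bounds(1)[OF assms(1,2)]
    by (intro mult_left_mono) auto
  also have "\<dots> \<le> c * (t - s)"
    using \<open>s \<le> t\<close> by (intro order_trans[OF eq_refl mult_right_mono[OF assms(4)]]) auto
  finally have "?a * well' \<sigma> s + c * s \<le> ?a * well' \<sigma> t + c * t" by (simp add: right_diff_distrib)
  moreover have "\<tau> * (s - \<sigma>) \<le> \<tau> * (t - \<sigma>)" using \<open>s \<le> t\<close> assms(1) by (intro mult_left_mono) auto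
  ultimately show "site' \<sigma> \<tau> l s + c * s \<le> site' \<sigma> \<tau> l t + c * t"
    by (auto simp: site'_def)
qed simp

text \<open>
  The peak of the test sequence is placed at the first coordinate that is at most \<open>\<sigma>/4\<close>; it exists
  because the last coordinate is \<open>0\<close>.
\<close>

lemma norm_chain_grad_lower_bound:
  assumes \<tau>: "0 < \<tau>" "\<tau> < 1" and \<sigma>: "\<sigma> > 0" and "\<kappa> \<ge> 0" "d \<ge> 1" and x: "x \<in> E (d - 1)"
  shows "\<kappa>\<^sup>2 * \<tau> ^ 3 * \<sigma>\<^sup>2 / 8 \<le> (norm (chain_grad d (site' \<sigma> \<tau>) {l. Suc l < d} \<kappa> x))\<^sup>2"
proof -
  define m where "m = d - 1"
  have d: "d = Suc m" using \<open>d \<ge> 1\<close> by (simp add: m_def)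
  have xm: "coord x m = 0" using x by (simp add: E_def m_def)
  define p where "p = (LEAST l. coord x l \<le> \<sigma> / 4)"
  have p: "coord x p \<le> \<sigma> / 4" "p \<le> m" unfolding p_def
    using xm \<sigma> by (auto intro: LeastI[of _ m] Least_le)
  have before: "coord x l > \<sigma> / 4" if "l < p" for l
    using not_less_Least[of l "\<lambda>l. coord x l \<le> \<sigma> / 4"] that by (simp add: p_def)
  let ?w = "bump \<tau> p"
  let ?G = "chain_grad d (site' \<sigma> \<tau>) {l. Suc l < d} \<kappa> x"
  define W where "W = (\<Sum>l<d. ?w l *\<^sub>R unit_vec l)"
  have coord_W: "coord W l = (if l < d then ?w l else 0)" for l
    by (auto simp: W_def if_distrib cong: if_cong)
  have W: "W \<in> E d" by (simp add: E_def coord_W)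
  have norm_W: "\<tau> * (norm W)\<^sup>2 \<le> 2"
    using sum_bump_square[where \<tau> = \<tau> and d = d and p = p] \<tau> by (simp add: norm_square_E[OF W] coord_W)
  have sites: "(\<Sum>l<d. site' \<sigma> \<tau> l (coord x l) * coord W l) =
      \<tau> * (coord x 0 - \<sigma>) * ?w 0 + \<tau>\<^sup>2 / (1 - \<tau>) * (\<Sum>l<Suc m. ?w l * well' \<sigma> (coord x l))"
  proof -
    have "(\<Sum>l<d. site' \<sigma> \<tau> l (coord x l) * coord W l) =
        (\<Sum>l<d. (if l = 0 then \<tau> * (coord x 0 - \<sigma>) * ?w 0 else 0)
          + \<tau>\<^sup>2 / (1 - \<tau>) * (?w l * well' \<sigma> (coord x l)))"
      by (intro sum.cong) (auto simp: site'_def coord_W algebra_simps)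
    also have "\<dots> = (\<Sum>l<d. if l = 0 then \<tau> * (coord x 0 - \<sigma>) * ?w 0 else 0)
        + \<tau>\<^sup>2 / (1 - \<tau>) * (\<Sum>l<d. ?w l * well' \<sigma> (coord x l))"
      by (simp only: sum.distrib sum_distrib_left)
    finally show ?thesis by (simp add: d del: sum.lessThan_Suc)
  qed
  have rows: "(\<Sum>l\<in>{l. Suc l < d}. (coord x l - coord x (Suc l)) * (coord W l - coord W (Suc l)))
      = (\<Sum>l<m. (coord x l - coord x (Suc l)) * (?w l - ?w (Suc l)))"
    by (intro sum.cong) (auto simp: d coord_W)
  have "inner ?G W \<le> \<kappa> * - (\<tau> * \<sigma> / 2)"
    unfolding inner_chain_grad sites rows
    using bump_test[OF \<tau> \<sigma> p(2,1) before xm] \<open>\<kappa> \<ge> 0\<close>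
    by (intro mult_left_mono) (auto simp: algebra_simps simp del: sum.lessThan_Suc)
  then have "\<kappa> * (\<tau> * \<sigma> / 2) \<le> \<bar>inner ?G W\<bar>" by simp
  also have "\<dots> \<le> norm ?G * norm W" by (rule Cauchy_Schwarz_ineq2)
  finally have "(\<kappa> * (\<tau> * \<sigma> / 2))\<^sup>2 \<le> (norm ?G * norm W)\<^sup>2"
    using \<tau> \<sigma> \<open>\<kappa> \<ge> 0\<close> by (intro power_mono) auto
  then have "\<tau> * (\<kappa> * (\<tau> * \<sigma> / 2))\<^sup>2 \<le> \<tau> * (norm ?G * norm W)\<^sup>2"
    using \<tau> by (intro mult_left_mono) auto
  also have "\<dots> = (norm ?G)\<^sup>2 * (\<tau> * (norm W)\<^sup>2)" by (simp add: power_mult_distrib)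
  also have "\<dots> \<le> (norm ?G)\<^sup>2 * 2" using norm_W by (intro mult_left_mono) auto
  finally show ?thesis 
    by (simp add: power_mult_distrib power_divide power2_eq_square power3_eq_cube mult_ac)
qed

text \<open>
  The boundary term makes the gradient at \<open>0\<close> a multiple of the first unit vector, so it is combined
  with the odd couplings: that component preserves the odd levels, and the one with the even
  couplings preserves the even levels.
\<close>

definition hard_problem ::
  "nat \<Rightarrow> nat \<Rightarrow> real \<Rightarrow> real \<Rightarrow> real \<Rightarrow> nat \<Rightarrow> nat \<Rightarrow> fs_problem" where
  "hard_problem n d \<sigma> \<tau> \<kappa> i j =
     \<lparr>dimen = d, feasible = E d,
      component = (\<lambda>k. if k = i then chain d (site \<sigma> \<tau>) {l. Suc l < d \<and> odd l} (n * \<kappa>)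
                       else if k = j then chain d (\<lambda>_ _. 0) {l. Suc l < d \<and> even l} (n * \<kappa>)
                       else (\<lambda>_. 0))\<rparr>"

lemma hard_problem_sel [simp]:
  "dimen (hard_problem n d \<sigma> \<tau> \<kappa> i j) = d" "feasible (hard_problem n d \<sigma> \<tau> \<kappa> i j) = E d"
  by (simp_all add: hard_problem_def)

lemma sum_two_indices:
  fixes a b :: real
  assumes "finite S" "i \<in> S" "j \<in> S" "i \<noteq> j"
  shows "(\<Sum>k\<in>S. if k = i then a else if k = j then b else 0) = a + b"
proof -
  have "(\<Sum>k\<in>S. if k = i then a else if k = j then b else 0)
      = (\<Sum>k\<in>S. (if k = i then a else 0) + (if k = j then b else 0))"
    using assms(4) by (intro sum.cong) auto
  then show ?thesis using assms by (simp add: sum.distrib)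
qed

context
  fixes n d i j :: nat and \<sigma> \<tau> \<kappa> :: real and P :: fs_problem
  assumes ij: "i \<in> {1..n}" "j \<in> {1..n}" "i \<noteq> j"
    and \<tau>: "0 < \<tau>" "\<tau> \<le> 1 / 2" and \<sigma>: "\<sigma> > 0" and \<kappa>: "\<kappa> > 0"
  defines "P \<equiv> hard_problem n d \<sigma> \<tau> \<kappa> i j"
begin

lemma component_hard_problem:
  "component P i = chain d (site \<sigma> \<tau>) {l. Suc l < d \<and> odd l} (n * \<kappa>)"
  "component P j = chain d (\<lambda>_ _. 0) {l. Suc l < d \<and> even l} (n * \<kappa>)"
  "k \<noteq> i \<Longrightarrow> k \<noteq> j \<Longrightarrow> component P k = (\<lambda>_. 0)"
  using ij by (auto simp: P_def hard_problem_def)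

lemma objective_hard_problem:
  "objective n P = chain d (site \<sigma> \<tau>) {l. Suc l < d} \<kappa>"
proof
  fix x
  let ?r = "\<lambda>l. (coord x l - coord x (Suc l))\<^sup>2"
  have fin: "finite {l. Suc l < d \<and> Q l}" for Q by (rule finite_subset[of _ "{..<d}"]) auto
  have rows: "{l. Suc l < d} = {l. Suc l < d \<and> odd l} \<union> {l. Suc l < d \<and> even l}" by auto
  have "sum ?r {l. Suc l < d} = sum ?r {l. Suc l < d \<and> odd l} + sum ?r {l. Suc l < d \<and> even l}"
    unfolding rows by (rule sum.union_disjoint) (auto intro: fin)
  then have "component P i x + component P j x = n * chain d (site \<sigma> \<tau>) {l. Suc l < d} \<kappa> x"
    by (simp add: component_hard_problem chain_def algebra_simps)
  moreover have "(\<Sum>k=1..n. component P k x) =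
      (\<Sum>k=1..n. if k = i then component P i x else if k = j then component P j x else 0)"
    by (intro sum.cong) (auto simp: component_hard_problem)
  then have "(\<Sum>k=1..n. component P k x) = component P i x + component P j x"
    using ij by (simp add: sum_two_indices)
  ultimately show "objective n P x = chain d (site \<sigma> \<tau>) {l. Suc l < d} \<kappa> x"
    using ij by (simp add: objective_def)
qed

lemma zero_chain_hard_problem: "zero_chain n {i, j} P"
proof -
  have "preserves k (component P i)" if "odd k" for k
    unfolding component_hard_problem
  proof (rule chain_preserves[OF DERIV_site])
    show "site' \<sigma> \<tau> l 0 = 0" if "k \<le> l" for l
      using that \<open>odd k\<close> \<sigma> by (cases "l = 0") (auto simp: site'_def)
  qed (use that in auto)
  moreover have "preserves k (component P j)" if "even k" for k
    unfolding component_hard_problem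
    by (rule chain_preserves[where \<phi>' = "\<lambda>_ _. 0"]) (use that in auto)
  moreover have "preserves k (component P m)" if "m \<noteq> i" "m \<noteq> j" for k m
  proof -
    have "((\<lambda>_. 0) has_derivative inner 0) (at y)" for y :: rvec
      by (simp add: inner_zero_left[abs_def])
    then show ?thesis
      unfolding component_hard_problem(3)[OF that] preserves_def by (intro ballI bexI[of _ 0]) auto
  qed
  ultimately show ?thesis
    using ij unfolding zero_chain_def P_def[symmetric]
    by (auto simp: P_def) (metis even_Suc)+
qed

lemma grad_objective_hard_problem:
  "x \<in> E d \<Longrightarrow> grad d (objective n P) x = chain_grad d (site' \<sigma> \<tau>) {l. Suc l < d} \<kappa> x"
  unfolding objective_hard_problem
  by (intro grad_eqI chain_grad_in_E chain_has_derivative DERIV_site) auto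

lemma average_smooth_hard_problem:
  assumes "64 * n * \<kappa>\<^sup>2 \<le> L\<^sup>2"
  shows "average_smooth n L P"
  unfolding average_smooth_def
proof (intro ballI)
  fix x y assume "x \<in> feasible P" "y \<in> feasible P"
  then have xy: "x \<in> E d" "y \<in> E d" by (simp_all add: P_def)
  let ?D = "\<lambda>k. norm (grad d (component P k) x - grad d (component P k) y)"
  have grad_i: "grad d (component P i) z =
      chain_grad d (site' \<sigma> \<tau>) {l. Suc l < d \<and> odd l} (n * \<kappa>) z" if "z \<in> E d" for z
    unfolding component_hard_problem
    by (intro grad_eqI chain_grad_in_E chain_has_derivative DERIV_site that) auto
  have grad_j: "grad d (component P j) z =
      chain_grad d (\<lambda>_ _. 0) {l. Suc l < d \<and> even l} (n * \<kappa>) z" if "z \<in> E d" for z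
    unfolding component_hard_problem
    by (intro grad_eqI chain_grad_in_E chain_has_derivative that) auto
  have grad_0: "grad d (\<lambda>_. 0) z = 0" if "z \<in> E d" for z
    using that by (intro grad_eqI) (simp_all add: inner_zero_left[abs_def])
  have Di: "?D i \<le> n * \<kappa> * (2 + 4) * norm (x - y)"
    unfolding grad_i[OF xy(1)] grad_i[OF xy(2)]
    using \<tau> \<sigma> \<kappa> by (intro chain_grad_lipschitz site'_lipschitz xy) auto
  have Dj: "?D j \<le> n * \<kappa> * (0 + 4) * norm (x - y)"
    unfolding grad_j[OF xy(1)] grad_j[OF xy(2)]
    using \<kappa> by (intro chain_grad_lipschitz xy) auto
  have "(\<Sum>k=1..n. (?D k)\<^sup>2) = (\<Sum>k=1..n. if k = i then (?D i)\<^sup>2 else if k = j then (?D j)\<^sup>2 else 0)"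
    by (intro sum.cong) (auto simp: component_hard_problem grad_0 xy)
  also have "\<dots> = (?D i)\<^sup>2 + (?D j)\<^sup>2" using ij by (simp add: sum_two_indices)
  also have "\<dots> \<le> (n * \<kappa> * (2 + 4) * norm (x - y))\<^sup>2 + (n * \<kappa> * (0 + 4) * norm (x - y))\<^sup>2"
    by (intro add_mono power_mono Di Dj) auto
  also have "\<dots> = n * (52 * n * \<kappa>\<^sup>2 * (norm (x - y))\<^sup>2)"
    by (simp add: power_mult_distrib power2_eq_square)
  also have "\<dots> \<le> n * (L\<^sup>2 * (norm (x - y))\<^sup>2)"
  proof (intro mult_left_mono mult_right_mono)
    have "52 * (n * \<kappa>\<^sup>2) \<le> 64 * (n * \<kappa>\<^sup>2)" by (intro mult_right_mono) auto
    with assms show "52 * n * \<kappa>\<^sup>2 \<le> L\<^sup>2" unfolding mult.assoc by linarith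
  qed auto
  finally show "(\<Sum>k=1..n. (norm (grad (dimen P) (component P k) x - grad (dimen P) (component P k) y))\<^sup>2)
      / real n \<le> L\<^sup>2 * (norm (x - y))\<^sup>2"
    using ij by (simp add: P_def pos_divide_le_eq mult.commute)
qed

text \<open>
  At \<open>0\<close> only the boundary term contributes, and each coordinate can lower the value by at most
  the depth \<open>3/8 * \<sigma>\<^sup>2\<close> of a well. Every well is weakly convex with constant \<open>3\<close>.
\<close>

lemma hard_problem_in_F_NC:
  assumes d: "d \<ge> 1"
    and L: "64 * n * \<kappa>\<^sup>2 \<le> L\<^sup>2"
    and \<mu>: "3 * (\<tau>\<^sup>2 / (1 - \<tau>)) * \<kappa> \<le> \<mu>"
    and \<Delta>: "\<kappa> * \<sigma>\<^sup>2 * (\<tau> / 2 + 3 / 4 * \<tau>\<^sup>2 * d) \<le> \<Delta>"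
  shows "P \<in> F_NC n \<Delta> L \<mu>"
proof -
  let ?F = "chain d (site \<sigma> \<tau>) {l. Suc l < d} \<kappa>"
  let ?a = "\<tau>\<^sup>2 / (1 - \<tau>)"
  have diff: "component P k differentiable_on E d" for k
  proof -
    have "preserves m (component P k) \<or> preserves (Suc m) (component P k)" for m
      using zero_chain_hard_problem by (auto simp: zero_chain_def)
    then have "\<exists>G. (component P k has_derivative inner G) (at x)" if "x \<in> E d" for x
      using that E_mono[of d "Suc d"] by (fastforce simp: preserves_def)
    then show ?thesis
      unfolding differentiable_on_def differentiable_def by (meson has_derivative_at_withinI)
  qed
  have "wf_problem n P"
    unfolding wf_problem_def using diff by (simp add: P_def closed_E convex_E)
  have low: "?F x \<ge> - \<kappa> * (d * (?a * (3 / 8 * \<sigma>\<^sup>2)))" for x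
  proof -
    have "(\<Sum>l<d. - (?a * (3 / 8 * \<sigma>\<^sup>2))) \<le> (\<Sum>l<d. site \<sigma> \<tau> l (coord x l))"
    proof (rule sum_mono)
      fix l
      have "?a * (- (3 / 8) * \<sigma>\<^sup>2) \<le> ?a * well \<sigma> (coord x l)"
        using well_weight_bounds(1)[OF \<tau>] well_lower_bound[of \<sigma>] \<sigma> by (intro mult_left_mono) auto
      moreover have "0 \<le> \<tau> / 2 * (coord x l - \<sigma>)\<^sup>2" using \<tau> by simp
      ultimately show "- (?a * (3 / 8 * \<sigma>\<^sup>2)) \<le> site \<sigma> \<tau> l (coord x l)"
        by (auto simp: site_def)
    qed
    moreover have "0 \<le> (\<Sum>l\<in>{l. Suc l < d}. (coord x l - coord x (Suc l))\<^sup>2)" by (rule sum_nonneg) simp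
    ultimately have "- (d * (?a * (3 / 8 * \<sigma>\<^sup>2))) \<le> (\<Sum>l<d. site \<sigma> \<tau> l (coord x l))
        + 1 / 2 * (\<Sum>l\<in>{l. Suc l < d}. (coord x l - coord x (Suc l))\<^sup>2)"
      by simp
    from mult_left_mono[OF this, of \<kappa>] \<kappa> show ?thesis by (simp add: chain_def)
  qed
  have F0: "?F 0 = \<kappa> * (\<tau> / 2 * \<sigma>\<^sup>2)"
    using \<sigma> d by (simp add: chain_def site_def)
  have bdd: "bdd_below (?F ` E d)" using low by (intro bdd_belowI2) auto
  have "- \<kappa> * (d * (?a * (3 / 8 * \<sigma>\<^sup>2))) \<le> (INF x\<in>E d. ?F x)"
    using low by (intro cINF_greatest) (use zero_in_E in blast)+
  moreover have "\<kappa> * (d * (?a * (3 / 8 * \<sigma>\<^sup>2))) \<le> \<kappa> * (d * (2 * \<tau>\<^sup>2 * (3 / 8 * \<sigma>\<^sup>2)))"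
    using well_weight_bounds(2)[OF \<tau>] \<kappa> by (intro mult_left_mono mult_right_mono) auto
  ultimately have gap: "?F 0 - (INF x\<in>E d. ?F x) \<le> \<Delta>"
    using \<Delta> unfolding F0 by (simp add: algebra_simps)
  have "weakly_convex_on (E d) \<mu> ?F"
  proof (rule chain_weakly_convex[OF \<kappa>])
    have "3 * ?a \<le> \<mu> / \<kappa>" using \<mu> \<kappa> by (simp add: pos_le_divide_eq)
    from site_weakly_convex[OF \<tau> _ this, of \<sigma>] \<sigma>
    show "convex_on UNIV (\<lambda>t. site \<sigma> \<tau> l t + \<mu> / (2 * \<kappa>) * t\<^sup>2)" for l
      by (simp add: mult.commute)
  qed
  then show ?thesis
    unfolding F_NC_def using \<open>wf_problem n P\<close> bdd gap average_smooth_hard_problem[OF L]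
    by (simp add: objective_hard_problem) (simp add: P_def)
qed

end

section \<open>The lower bound\<close>

text \<open>
  Rounding up turns a real lower bound into one within \<open>enat\<close>, where the infimum and supremum of
  the minimax time are taken.
\<close>

lemma ereal_le_ereal_of_enat_iff:
  "ereal X \<le> ereal_of_enat e \<longleftrightarrow> enat (nat \<lceil>X\<rceil>) \<le> e"
  by (cases e) (auto simp: ceiling_le_iff nat_le_iff)

lemma minimax_time_lower_bound:
  assumes "\<And>A. A \<in> PIFO c n \<Longrightarrow> \<exists>P\<in>\<F>. ereal X \<le> ereal_of_enat (hitting_time n A P \<epsilon>)"
  shows "ereal X \<le> ereal_of_enat (minimax_time c n \<F> \<epsilon>)"
  unfolding ereal_le_ereal_of_enat_iff minimax_time_def
proof (rule INF_greatest)
  fix A assume "A \<in> PIFO c n"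
  then obtain P where "P \<in> \<F>" "enat (nat \<lceil>X\<rceil>) \<le> hitting_time n A P \<epsilon>"
    using assms by (auto simp: ereal_le_ereal_of_enat_iff)
  then show "enat (nat \<lceil>X\<rceil>) \<le> (SUP P\<in>\<F>. hitting_time n A P \<epsilon>)" by (rule SUP_upper2)
qed

lemma alpha_NC_bounds:
  assumes "n \<ge> 2" "L > 0" "\<mu> > 0"
  shows "0 < alpha_NC n L \<mu>" "alpha_NC n L \<mu> \<le> 1" "alpha_NC n L \<mu> * L \<le> sqrt n * \<mu> / 2"
proof -
  have "8 * (sqrt 3 + 1) * sqrt n * \<mu> / (45 * L) > 0"
    using assms by (intro divide_pos_pos mult_pos_pos add_nonneg_pos) auto
  then show "0 < alpha_NC n L \<mu>" using assms by (simp add: alpha_NC_def)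
  show "alpha_NC n L \<mu> \<le> 1" by (simp add: alpha_NC_def)
  have "sqrt 3 \<le> 9 / 5" by (rule real_le_lsqrt) (auto simp: power2_eq_square)
  then have "8 * (sqrt 3 + 1) / 45 \<le> 1 / 2" by simp
  then have "8 * (sqrt 3 + 1) / 45 * (sqrt n * \<mu> / L) \<le> 1 / 2 * (sqrt n * \<mu> / L)"
    using assms by (intro mult_right_mono) auto
  moreover have "alpha_NC n L \<mu> \<le> 8 * (sqrt 3 + 1) * sqrt n * \<mu> / (45 * L)"
    by (simp add: alpha_NC_def)
  ultimately have "alpha_NC n L \<mu> \<le> 1 / 2 * (sqrt n * \<mu> / L)" by (simp add: field_simps)
  then show "alpha_NC n L \<mu> * L \<le> sqrt n * \<mu> / 2"
    using assms by (simp add: field_simps)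
qed

text \<open>
  Here \<open>\<kappa>\<close> is dictated by average smoothness, \<open>\<tau>\<close> by weak convexity, \<open>\<sigma>\<close> by the requirement that
  the gradient have norm at least \<open>2 * \<epsilon>\<close>, and \<open>d\<close> is the largest length that the gap \<open>\<Delta>\<close>
  admits. The bound on \<open>\<epsilon>\<close> enters only through \<open>Q \<ge> 425\<close>, which makes the rounding in \<open>d\<close>
  harmless and lets \<open>n * Q / \<tau>\<close> dominate \<open>n\<close>.
\<close>

lemma hard_instance_exists:
  fixes n :: nat and L \<mu> \<Delta> \<epsilon> c \<alpha> :: real
  defines "\<alpha> \<equiv> alpha_NC n L \<mu>"
  assumes n: "n \<ge> 2" and pos: "L > 0" "\<mu> > 0" "\<Delta> > 0" "\<epsilon> > 0" "c > 0"
    and \<epsilon>: "\<epsilon>\<^sup>2 \<le> \<Delta> * L * \<alpha> / (435456 * sqrt n)"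
    and A: "A \<in> PIFO c n"
  shows "\<exists>P\<in>{P \<in> F_NC n \<Delta> L \<mu>. feasible P = E (dimen P)}.
    ereal (1 / (4096 * (4 + c)) * (n + \<Delta> * L * sqrt (n * \<alpha>) / \<epsilon>\<^sup>2))
      \<le> ereal_of_enat (hitting_time n A P \<epsilon>)"
proof -
  have \<alpha>: "0 < \<alpha>" "\<alpha> \<le> 1" "\<alpha> * L \<le> sqrt n * \<mu> / 2"
    using alpha_NC_bounds[OF n pos(1,2)] by (simp_all add: \<alpha>_def)
  define \<kappa> where "\<kappa> = L / (8 * sqrt n)"
  define \<tau> where "\<tau> = sqrt \<alpha> / 2"
  define \<sigma> where "\<sigma> = sqrt (32 * \<epsilon>\<^sup>2 / (\<kappa>\<^sup>2 * \<tau> ^ 3))"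
  \<comment> \<open>The gap condition follows from \<open>1 + \<tau> * d \<le> Q\<close>.\<close>
  define Q where "Q = \<Delta> * \<kappa> * \<tau>\<^sup>2 / (32 * \<epsilon>\<^sup>2)"
  define d where "d = nat \<lfloor>(Q - 1) / \<tau>\<rfloor>"
  have sn: "sqrt n > 0" "(sqrt n)\<^sup>2 = n" using n by auto
  have \<kappa>: "\<kappa> > 0" using pos sn by (simp add: \<kappa>_def)
  have \<tau>: "0 < \<tau>" "\<tau> \<le> 1 / 2" using \<alpha> by (auto simp: \<tau>_def)
  have \<tau>2: "\<tau>\<^sup>2 = \<alpha> / 4" using \<alpha> by (simp add: \<tau>_def power_divide)
  have \<sigma>2: "\<sigma>\<^sup>2 = 32 * \<epsilon>\<^sup>2 / (\<kappa>\<^sup>2 * \<tau> ^ 3)" using \<tau> by (simp add: \<sigma>_def)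
  have \<sigma>: "\<sigma> > 0" using \<tau> \<kappa> pos by (simp add: \<sigma>_def)
  have Q_eq: "Q = \<Delta> * L * \<alpha> / (1024 * sqrt n * \<epsilon>\<^sup>2)"
    unfolding Q_def \<tau>2 \<kappa>_def by simp
  define Z where "Z = \<Delta> * L * \<alpha> / (sqrt n * \<epsilon>\<^sup>2)"
  have "435456 \<le> Z" unfolding Z_def using \<epsilon> pos sn by (simp add: field_simps)
  moreover have "Q = Z / 1024" unfolding Q_eq Z_def by simp
  ultimately have Q: "Q \<ge> 425" by simp
  have d_le: "d \<le> (Q - 1) / \<tau>" and d_ge: "(Q - 1) / \<tau> - 1 \<le> d"
    using Q \<tau> by (auto simp: d_def)
  have "Q / 2 \<le> Q - 1 - 2 * \<tau>" using Q \<tau> by linarith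
  then have "Q / 2 / \<tau> \<le> (Q - 1 - 2 * \<tau>) / \<tau>" using \<tau> by (intro divide_right_mono) auto
  also have "\<dots> = (Q - 1) / \<tau> - 2" using \<tau> by (simp add: diff_divide_distrib)
  also have "\<dots> \<le> real d - 1" using d_ge by simp
  finally have d1: "Q / (2 * \<tau>) \<le> real d - 1" by simp
  have "Q / (2 * \<tau>) \<ge> 425 / (2 * (1 / 2))" using Q \<tau> by (intro frac_le) auto
  with d1 have d2: "d \<ge> 2" by simp
  obtain i j where ij: "i \<in> {1..n}" "j \<in> {1..n}" "i \<noteq> j"
    "pmf (index_dist A) i \<le> 2 / n" "pmf (index_dist A) j \<le> 2 / n"
    using two_unlikely_indices[OF n, of "index_dist A"] by metis
  have prob: "measure_pmf.prob (index_dist A) {i, j} \<le> 4 / n"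
    using ij by (simp add: measure_measure_pmf_finite)
  define P where "P = hard_problem n d \<sigma> \<tau> \<kappa> i j"
  have dimP: "dimen P = d" "feasible P = E d" by (simp_all add: P_def)
  have "P \<in> F_NC n \<Delta> L \<mu>"
    unfolding P_def
  proof (rule hard_problem_in_F_NC[OF ij(1-3) \<tau> \<sigma> \<kappa>])
    show "64 * n * \<kappa>\<^sup>2 \<le> L\<^sup>2" using n by (simp add: \<kappa>_def power_divide power_mult_distrib)
    have "3 * (\<tau>\<^sup>2 / (1 - \<tau>)) * \<kappa> \<le> 3 * (2 * \<tau>\<^sup>2) * \<kappa>"
      using well_weight_bounds(2)[OF \<tau>] \<kappa> by (intro mult_right_mono mult_left_mono) auto
    also have "\<dots> = 3 / 16 * (\<alpha> * L) / sqrt n" by (simp add: \<tau>2 \<kappa>_def)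
    also have "\<dots> \<le> 3 / 16 * (sqrt n * \<mu> / 2) / sqrt n"
      using \<alpha>(3) sn by (intro divide_right_mono mult_left_mono) auto
    also have "\<dots> \<le> \<mu>" using sn pos by simp
    finally show "3 * (\<tau>\<^sup>2 / (1 - \<tau>)) * \<kappa> \<le> \<mu>" .
    have "\<kappa> * \<sigma>\<^sup>2 * (\<tau> / 2 + 3 / 4 * \<tau>\<^sup>2 * d) = 32 * \<epsilon>\<^sup>2 / (\<kappa> * \<tau>\<^sup>2) * (1 / 2 + 3 / 4 * (\<tau> * d))"
      unfolding \<sigma>2 using \<kappa> \<tau> by (simp add: field_simps power2_eq_square power3_eq_cube)
    also have "\<dots> \<le> 32 * \<epsilon>\<^sup>2 / (\<kappa> * \<tau>\<^sup>2) * Q"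
    proof (rule mult_left_mono)
      have "\<tau> * d \<le> Q - 1" using d_le \<tau> by (simp add: field_simps)
      moreover have "0 \<le> \<tau> * d" using \<tau> by simp
      ultimately show "1 / 2 + 3 / 4 * (\<tau> * d) \<le> Q" by linarith
    qed (use \<kappa> in simp)
    also have "\<dots> = \<Delta>" using \<kappa> \<tau> pos by (simp add: Q_def)
    finally show "\<kappa> * \<sigma>\<^sup>2 * (\<tau> / 2 + 3 / 4 * \<tau>\<^sup>2 * d) \<le> \<Delta>" .
  qed (use d2 in simp)
  moreover have "ereal (n * real (dimen P - 1) / (2 * (4 + c))) \<le> ereal_of_enat (hitting_time n A P \<epsilon>)"
  proof (rule hitting_time_lower_bound[OF _ A prob])
    show "zero_chain n {i, j} P"
      unfolding P_def by (rule zero_chain_hard_problem[OF ij(1-3) \<tau> \<sigma> \<kappa>])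
    fix x assume x: "x \<in> E (dimen P - 1)"
    have "(2 * \<epsilon>)\<^sup>2 = \<kappa>\<^sup>2 * \<tau> ^ 3 * \<sigma>\<^sup>2 / 8"
      unfolding \<sigma>2 using \<kappa> \<tau> by (simp add: power_mult_distrib)
    also have "\<dots> \<le> (norm (chain_grad d (site' \<sigma> \<tau>) {l. Suc l < d} \<kappa> x))\<^sup>2"
      using \<tau> \<sigma> \<kappa> d2 x dimP by (intro norm_chain_grad_lower_bound) auto
    also have "chain_grad d (site' \<sigma> \<tau>) {l. Suc l < d} \<kappa> x = grad d (objective n P) x"
      unfolding P_def using x dimP E_mono[of "d - 1" d]
      by (intro grad_objective_hard_problem[OF ij(1-3) \<tau> \<sigma> \<kappa>, symmetric]) auto
    finally show "2 * \<epsilon> \<le> norm (grad (dimen P) (objective n P) x)"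
      unfolding dimP by (rule power2_le_imp_le) simp
  qed (use d2 dimP pos in auto)
  moreover have "1 / (4096 * (4 + c)) * (n + \<Delta> * L * sqrt (n * \<alpha>) / \<epsilon>\<^sup>2)
      \<le> n * real (dimen P - 1) / (2 * (4 + c))"
  proof -
    define V where "V = n * (Q / \<tau>)"
    define Y where "Y = \<Delta> * L * sqrt (n * \<alpha>) / \<epsilon>\<^sup>2"
    have "V = Y / 512"
    proof -
      have n_eq: "real n = sqrt n * sqrt n" and \<alpha>_eq: "\<alpha> = sqrt \<alpha> * sqrt \<alpha>" using \<alpha> by auto
      have "n * (Q / \<tau>) = sqrt n * sqrt n * (\<Delta> * L * (sqrt \<alpha> * sqrt \<alpha>) / (1024 * sqrt n * \<epsilon>\<^sup>2) / (sqrt \<alpha> / 2))"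
        unfolding Q_eq \<tau>_def using n_eq \<alpha>_eq by simp
      also have "\<dots> = \<Delta> * L * (sqrt n * sqrt \<alpha>) / \<epsilon>\<^sup>2 / 512"
        using sn \<alpha> pos by (simp add: field_simps del: real_sqrt_mult_self)
      finally show ?thesis by (simp add: V_def Y_def real_sqrt_mult)
    qed
    moreover have "real n * 1 \<le> V"
      unfolding V_def using Q \<tau> by (intro mult_left_mono) (auto simp: pos_le_divide_eq)
    ultimately have "(n + Y) / 2048 \<le> V / 2" by simp
    also have "V / 2 = n * (Q / (2 * \<tau>))" by (simp add: V_def)
    also have "\<dots> \<le> n * real (d - 1)" using d1 d2 by (intro mult_left_mono) (auto simp: of_nat_diff)
    finally have "(n + Y) / 2048 / (2 * (4 + c)) \<le> n * real (d - 1) / (2 * (4 + c))"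
      using pos by (intro divide_right_mono) auto
    then show ?thesis by (simp add: Y_def dimP mult_ac)
  qed
  ultimately show ?thesis
    using dimP by (intro bexI[of _ P]) (auto intro: order_trans[rotated])
qed

theorem theoremE11:
  fixes c\<^sub>0 :: real
  assumes "c\<^sub>0 > 0"
  shows "\<exists>c>0. \<forall>(n::nat) (L::real) (\<mu>::real) (\<Delta>::real) (\<epsilon>::real).
           n \<ge> 2 \<longrightarrow> L > 0 \<longrightarrow> \<mu> > 0 \<longrightarrow> \<Delta> > 0 \<longrightarrow> \<epsilon> > 0 \<longrightarrow>
           \<epsilon>\<^sup>2 \<le> \<Delta> * L * alpha_NC n L \<mu> / (435456 * sqrt (real n)) \<longrightarrow>
             ereal_of_enat (m_NC c\<^sub>0 n \<epsilon> \<Delta> L \<mu>)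
               \<ge> ereal (c * (real n + \<Delta> * L * sqrt (real n * alpha_NC n L \<mu>) / \<epsilon>\<^sup>2)) \<and>
             ereal_of_enat (m_NC_unconstrained c\<^sub>0 n \<epsilon> \<Delta> L \<mu>)
               \<ge> ereal (c * (real n + \<Delta> * L * sqrt (real n * alpha_NC n L \<mu>) / \<epsilon>\<^sup>2))"
proof (intro exI[of _ "1 / (4096 * (4 + c\<^sub>0))"] conjI allI impI)
  show "1 / (4096 * (4 + c\<^sub>0)) > 0" using assms by simp
  fix n :: nat and L \<mu> \<Delta> \<epsilon> :: real
  assume "n \<ge> 2" "L > 0" "\<mu> > 0" "\<Delta> > 0" "\<epsilon> > 0"
    and "\<epsilon>\<^sup>2 \<le> \<Delta> * L * alpha_NC n L \<mu> / (435456 * sqrt (real n))"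
  note hard = hard_instance_exists[OF this(1-5) assms this(6)]
  show "ereal_of_enat (m_NC c\<^sub>0 n \<epsilon> \<Delta> L \<mu>)
      \<ge> ereal (1 / (4096 * (4 + c\<^sub>0)) * (real n + \<Delta> * L * sqrt (real n * alpha_NC n L \<mu>) / \<epsilon>\<^sup>2))"
    unfolding m_NC_def by (rule minimax_time_lower_bound) (use hard in blast)
  show "ereal_of_enat (m_NC_unconstrained c\<^sub>0 n \<epsilon> \<Delta> L \<mu>)
      \<ge> ereal (1 / (4096 * (4 + c\<^sub>0)) * (real n + \<Delta> * L * sqrt (real n * alpha_NC n L \<mu>) / \<epsilon>\<^sup>2))"
    unfolding m_NC_unconstrained_def by (rule minimax_time_lower_bound) (rule hard)
qed

end
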